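(* When $d\ge 2k+1$, the full automorphism group of the Klee–Novik complex $M(k,d)$ is of order $4d+8$; namely, it is the group generated by the vertex permutations $$D=\prod_{j=1}^{d+2}(x_j,y_j),\qquad E=\prod_{1\le j<(d+3)/2}(x_j,x_{d+3-j})(y_j,y_{d+3-j}),$$ and $R$, where $R=(x_1,\dots,x_{d+2})(y_1,\dots,y_{d+2})$ if $k$ is even and $R=(x_1,\dots,x_{d+2},y_1,\dots,y_{d+2})$ if $k$ is odd.
   Context: The Klee–Novik complexes: for $d\ge 1$, let $S^{d+1}_{2d+4}$ be the join of $d+2$ copies of the two-point complex $S^0_2$ with disjoint vertex sets $\{x_i,y_i\}$, $1\le i\le d+2$ (the boundary complex of the $(d+2)$-dimensional cross polytope). Each facet $\sigma$ contains exactly one of $x_i,y_i$ for each $i$; encode it by the sign sequence $(\varepsilon_1,\dots,\varepsilon_{d+2})$ with $\varepsilon_i=+$ if $x_i\in\sigma$ and $\varepsilon_i=-$ if $y_i\in\sigma$. A sign change is an index $1\le i\le d+1$ with $\varepsilon_{i+1}\ne\varepsilon_i$. For $0\le k\le d$, $\overline{M}(k,d)$ is the pure $(d+1)$-dimensional subcomplex of $S^{d+1}_{2d+4}$ whose facets are those with at most $k$ sign changes, and $M(k,d):=\partial\overline{M}(k,d)$ is its boundary, i.e. the pure subcomplex whose facets are the $d$-faces lying in exactly one facet of $\overline{M}(k,d)$. An automorphism of a simplicial complex is a permutation of its vertex set mapping faces to faces. Permutations are written in cycle notation.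
   Formalization: The case k = 0 is excluded (k ≥ 1 is assumed): M(0,d) is two disjoint boundaries of (d+1)-simplices, whose automorphism group has order 2((d+2)!)², not 4d+8. *)

theory Defs
  imports "HOL-Combinatorics.Cycles" "HOL-Algebra.Generated_Groups" "HOL-Algebra.Coset"
begin

section \<open>Finite abstract simplicial complexes\<close>

text \<open>A complex is its set of faces; the empty face is included.\<close>

definition vertices :: "'a set set \<Rightarrow> 'a set" where
  "vertices K = \<Union>K"

definition facets :: "'a set set \<Rightarrow> 'a set set" where
  "facets K = {\<sigma> \<in> K. \<forall>\<tau>\<in>K. \<sigma> \<subseteq> \<tau> \<longrightarrow> \<tau> = \<sigma>}"

definition join :: "'a set set \<Rightarrow> 'a set set \<Rightarrow> 'a set set" where
  "join K L = {\<sigma> \<union> \<tau> | \<sigma> \<tau>. \<sigma> \<in> K \<and> \<tau> \<in> L}"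

definition spanned_by :: "'a set set \<Rightarrow> 'a set set" where
  "spanned_by F = {\<sigma>. \<exists>\<tau>\<in>F. \<sigma> \<subseteq> \<tau>}"

text \<open>For \<open>K\<close> pure of dimension \<open>d + 1\<close>; a \<open>d\<close>-face has \<open>d + 1\<close> vertices.\<close>

definition boundary_complex :: "nat \<Rightarrow> 'a set set \<Rightarrow> 'a set set" where
  "boundary_complex d K =
     spanned_by {\<tau> \<in> K. card \<tau> = d + 1 \<and> card {\<sigma> \<in> facets K. \<tau> \<subseteq> \<sigma>} = 1}"

text \<open>Vertex permutations are total functions that are the identity off the vertex set.\<close>

definition symmetric_group_on :: "'a set \<Rightarrow> ('a \<Rightarrow> 'a) monoid" where
  "symmetric_group_on V = \<lparr>carrier = {p. p permutes V}, monoid.mult = (\<circ>), one = id\<rparr>"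

definition automorphism_group :: "'a set set \<Rightarrow> ('a \<Rightarrow> 'a) monoid" where
  "automorphism_group K =
     \<lparr>carrier = {p. p permutes vertices K \<and> (\<forall>\<sigma>\<in>K. p ` \<sigma> \<in> K)},
      monoid.mult = (\<circ>), one = id\<rparr>"

section \<open>The Klee--Novik complexes\<close>

datatype vertex = X nat | Y nat

definition two_points :: "nat \<Rightarrow> vertex set set" where
  "two_points i = {{}, {X i}, {Y i}}"

text \<open>The complex \<open>{{}}\<close> is the neutral element of \<open>join\<close>.\<close>

definition cross_polytope_sphere :: "nat \<Rightarrow> vertex set set" where
  "cross_polytope_sphere d = foldr join (map two_points [1..<d + 3]) {{}}"

text \<open>On facets of the cross polytope, \<open>True\<close> encodes the sign \<open>+\<close>, \<open>False\<close> the sign \<open>-\<close>.\<close>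

definition sign_at :: "vertex set \<Rightarrow> nat \<Rightarrow> bool" where
  "sign_at \<sigma> i \<longleftrightarrow> X i \<in> \<sigma>"

definition sign_changes :: "nat \<Rightarrow> vertex set \<Rightarrow> nat set" where
  "sign_changes d \<sigma> = {i \<in> {1..d + 1}. sign_at \<sigma> (i + 1) \<noteq> sign_at \<sigma> i}"

definition KN_filled :: "nat \<Rightarrow> nat \<Rightarrow> vertex set set" where
  "KN_filled k d =
     spanned_by {\<sigma> \<in> facets (cross_polytope_sphere d). card (sign_changes d \<sigma>) \<le> k}"

definition KN :: "nat \<Rightarrow> nat \<Rightarrow> vertex set set" where
  "KN k d = boundary_complex d (KN_filled k d)"

section \<open>The three vertex permutations\<close>

definition perm_D :: "nat \<Rightarrow> vertex \<Rightarrow> vertex" where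
  "perm_D d = foldr (\<circ>) [cycle_of_list [X j, Y j]. j \<leftarrow> [1..<d + 3]] id"

text \<open>\<open>2 * j < d + 3\<close> is the integral form of \<open>j < (d + 3) / 2\<close>.\<close>

definition perm_E :: "nat \<Rightarrow> vertex \<Rightarrow> vertex" where
  "perm_E d =
     foldr (\<circ>)
       [cycle_of_list [X j, X (d + 3 - j)] \<circ> cycle_of_list [Y j, Y (d + 3 - j)].
         j \<leftarrow> [1..<d + 3], 2 * j < d + 3] id"

definition perm_R :: "nat \<Rightarrow> nat \<Rightarrow> vertex \<Rightarrow> vertex" where
  "perm_R k d =
     (if even k
      then cycle_of_list (map X [1..<d + 3]) \<circ> cycle_of_list (map Y [1..<d + 3])
      else cycle_of_list (map X [1..<d + 3] @ map Y [1..<d + 3]))"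

end

theory Submission
  imports Defs
begin

text \<open>
  The facets of \<open>KN k d\<close> are the edges of the cube of sign sequences that leave the set of sequences with
  at most \<open>k\<close> sign changes. Every pair of non-antipodal vertices is an edge of \<open>KN k d\<close>, so an
  automorphism is a signed permutation of the coordinates; it preserves this edge cut of the cube, hence
  (comparing cardinalities) the set of sequences with at most \<open>k\<close> changes. The sequences all of whose
  neighbours stay in that set are those with at most \<open>k - 2\<close> changes, so one can descend to at most one
  change for odd \<open>k\<close>, and to at most two and at most zero changes for even \<open>k\<close>. These small sets
  remember which coordinates are cyclically adjacent, which leaves a dihedral action on the coordinates
  and two choices of global sign.
\<close>

section \<open>Transversals and flips\<close>

text \<open>An edge cut determines a vertex set of the cube only up to complement. This is where the
  bound on \<open>d\<close> enters: negating every second sign turns \<open>c\<close> changes into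
  \<open>d + 1 - c\<close>, so for \<open>d = 2 * k\<close> it would exchange the two sides of the
  cut and give an additional automorphism, whereas for \<open>2 * k + 1 \<le> d\<close> the outside
  is strictly larger. The same bound keeps runs of equal signs available at every level of the
  descent. For \<open>k = 0\<close> pairs such as \<open>X 1\<close>, \<open>Y 2\<close> are not
  edges, since the complex is then two disjoint boundaries of simplices. The descent keeps the
  parity of the level, hence the two endings. Level 0 consists of two antipodal sequences and knows
  nothing about the order of the coordinates, so even \<open>k\<close> needs level 2 beside it; for
  odd \<open>k\<close> level 1 serves both purposes. The order comes out as orbit times stabiliser:
  \<open>X 1\<close> has \<open>2 * (d + 2)\<close> images, and only the identity and one reflection
  fix it.\<close>

primrec opp :: "vertex \<Rightarrow> vertex" where
  "opp (X i) = Y i"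
| "opp (Y i) = X i"

primrec idx :: "vertex \<Rightarrow> nat" where
  "idx (X i) = i"
| "idx (Y i) = i"

definition polytope_vertices :: "nat \<Rightarrow> vertex set" where
  "polytope_vertices d = {v. idx v \<in> {1..d + 2}}"

text \<open>The facets of the cross polytope, that is, the vertices of the cube of sign
  sequences.\<close>

definition transversals :: "nat \<Rightarrow> vertex set set" where
  "transversals d =
     {\<sigma>. \<sigma> \<subseteq> polytope_vertices d \<and> (\<forall>i\<in>{1..d + 2}. Y i \<in> \<sigma> \<longleftrightarrow> X i \<notin> \<sigma>)}"

text \<open>Passage to the facet across the ridge that omits coordinate \<open>i\<close>; the
  symmetric difference makes it an involution on arbitrary sets.\<close>

definition flip :: "nat \<Rightarrow> vertex set \<Rightarrow> vertex set" where
  "flip i \<sigma> = sym_diff \<sigma> {X i, Y i}"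

lemma opp_opp [simp]: "opp (opp v) = v"
  by (cases v) auto

lemma idx_opp [simp]: "idx (opp v) = idx v"
  by (cases v) auto

lemma opp_neq [simp]: "opp v \<noteq> v" "v \<noteq> opp v"
  by (cases v; simp)+

lemma idx_eq_iff: "idx u = idx v \<longleftrightarrow> u = v \<or> u = opp v"
  by (cases u; cases v) auto

lemma mem_polytope_vertices [simp]:
  "v \<in> polytope_vertices d \<longleftrightarrow> 1 \<le> idx v \<and> idx v \<le> d + 2"
  by (auto simp: polytope_vertices_def)

lemma pair_idx: "{X (idx v), Y (idx v)} = {v, opp v}"
  by (cases v) auto

lemma polytope_vertices_eq: "polytope_vertices d = X ` {1..d + 2} \<union> Y ` {1..d + 2}"
proof (intro Set.set_eqI)
  fix v show "v \<in> polytope_vertices d \<longleftrightarrow> v \<in> X ` {1..d + 2} \<union> Y ` {1..d + 2}"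
    by (cases v) auto
qed

lemma finite_polytope_vertices [simp]: "finite (polytope_vertices d)"
  by (simp add: polytope_vertices_eq)

lemma finite_transversals [simp]: "finite (transversals d)"
  by (rule finite_subset[of _ "Pow (polytope_vertices d)"]) (auto simp: transversals_def)

lemma transversal_mem_idx:
  "\<sigma> \<in> transversals d \<Longrightarrow> v \<in> \<sigma> \<Longrightarrow> 1 \<le> idx v \<and> idx v \<le> d + 2"
  by (auto simp: transversals_def)

lemma transversal_opp:
  assumes "\<sigma> \<in> transversals d" "1 \<le> idx v" "idx v \<le> d + 2"
  shows "opp v \<in> \<sigma> \<longleftrightarrow> v \<notin> \<sigma>"
  using assms by (cases v) (auto simp: transversals_def)

lemma transversal_mem_iff:
  assumes "\<sigma> \<in> transversals d"
  shows "X i \<in> \<sigma> \<longleftrightarrow> i \<in> {1..d + 2} \<and> sign_at \<sigma> i"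
    and "Y i \<in> \<sigma> \<longleftrightarrow> i \<in> {1..d + 2} \<and> \<not> sign_at \<sigma> i"
  using transversal_mem_idx[OF assms, of "X i"] transversal_mem_idx[OF assms, of "Y i"]
    transversal_opp[OF assms, of "X i"]
  by (auto simp: sign_at_def)

lemma transversal_eqI:
  assumes "\<sigma> \<in> transversals d" "\<tau> \<in> transversals d"
    and "\<And>i. 1 \<le> i \<Longrightarrow> i \<le> d + 2 \<Longrightarrow> sign_at \<sigma> i = sign_at \<tau> i"
  shows "\<sigma> = \<tau>"
proof (intro Set.set_eqI)
  fix v show "v \<in> \<sigma> \<longleftrightarrow> v \<in> \<tau>"
    using assms(3) by (cases v) (auto simp: transversal_mem_iff[OF assms(1)] transversal_mem_iff[OF assms(2)])
qed

lemma transversal_of_signs: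
  obtains \<sigma> where "\<sigma> \<in> transversals d" "\<And>i. 1 \<le> i \<Longrightarrow> i \<le> d + 2 \<Longrightarrow> sign_at \<sigma> i = s i"
proof
  let ?\<sigma> = "X ` {i \<in> {1..d + 2}. s i} \<union> Y ` {i \<in> {1..d + 2}. \<not> s i}"
  show "?\<sigma> \<in> transversals d"
    by (auto simp: transversals_def)
  show "sign_at ?\<sigma> i = s i" if "1 \<le> i" "i \<le> d + 2" for i
    using that by (auto simp: sign_at_def)
qed

lemma card_transversal:
  assumes "\<sigma> \<in> transversals d"
  shows "card \<sigma> = d + 2"
proof -
  have "bij_betw idx \<sigma> {1..d + 2}"
  proof (rule bij_betwI')
    fix u v assume "u \<in> \<sigma>" "v \<in> \<sigma>"
    then show "(idx u = idx v) = (u = v)"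
      using transversal_opp[OF assms, of v] transversal_mem_idx[OF assms] by (auto simp: idx_eq_iff)
  next
    fix u assume "u \<in> \<sigma>" then show "idx u \<in> {1..d + 2}"
      using transversal_mem_idx[OF assms] by auto
  next
    fix i assume "i \<in> {1..d + 2}"
    then show "\<exists>v\<in>\<sigma>. i = idx v"
      by (cases "sign_at \<sigma> i") (metis idx.simps transversal_mem_iff[OF assms])+
  qed
  then show ?thesis using bij_betw_same_card by force
qed

lemma finite_transversal: "\<sigma> \<in> transversals d \<Longrightarrow> finite \<sigma>"
  using card_transversal[of \<sigma> d] card.infinite by fastforce

lemma flip_flip [simp]: "flip i (flip i \<sigma>) = \<sigma>"
  by (auto simp: flip_def)

lemma flip_transversal:
  "\<sigma> \<in> transversals d \<Longrightarrow> 1 \<le> i \<Longrightarrow> i \<le> d + 2 \<Longrightarrow> flip i \<sigma> \<in> transversals d"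
  by (fastforce simp: transversals_def flip_def)

lemma sign_at_flip: "sign_at (flip i \<sigma>) j \<longleftrightarrow> (sign_at \<sigma> j \<longleftrightarrow> i \<noteq> j)"
  by (auto simp: sign_at_def flip_def)

lemma mem_flip: "v \<in> flip i \<sigma> \<longleftrightarrow> (v \<in> \<sigma> \<longleftrightarrow> idx v \<noteq> i)"
  by (cases v) (auto simp: flip_def)

lemma flip_neq [simp]: "flip i \<sigma> \<noteq> \<sigma>"
  by (auto simp: flip_def)

text \<open>The graph of flips is a cube; one walks from \<open>\<sigma>\<close> to \<open>\<tau>\<close> through the signs where they differ.\<close>

lemma flip_connected:
  assumes "\<sigma> \<in> transversals d" "\<tau> \<in> transversals d" "Q \<sigma>"
    and step: "\<And>\<rho> j. \<rho> \<in> transversals d \<Longrightarrow> Q \<rho> \<Longrightarrow> 1 \<le> j \<Longrightarrow> j \<le> d + 2 \<Longrightarrow>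
      sign_at \<sigma> j \<noteq> sign_at \<tau> j \<Longrightarrow> Q (flip j \<rho>)"
  shows "Q \<tau>"
proof -
  define J where "J = {i \<in> {1..d + 2}. sign_at \<sigma> i \<noteq> sign_at \<tau> i}"
  \<comment> \<open>Induction on the set of signs in which \<open>\<rho>\<close> still differs from
    \<open>\<sigma>\<close>. Only signs in \<open>J\<close> get flipped, so vertices common to
    \<open>\<sigma>\<close> and \<open>\<tau>\<close> can be kept throughout the walk.\<close>
  have "Q \<rho>" if "finite I" "I \<subseteq> J" "\<rho> \<in> transversals d" "{i \<in> {1..d + 2}. sign_at \<sigma> i \<noteq> sign_at \<rho> i} = I"
    for I \<rho>
    using that
  proof (induction I arbitrary: \<rho> rule: finite_induct)
    case empty
    then have "\<rho> = \<sigma>" using assms(1) by (intro transversal_eqI[of _ d]) auto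
    then show ?case using assms by simp
  next
    case (insert j I)
    have j: "1 \<le> j" "j \<le> d + 2" "sign_at \<sigma> j \<noteq> sign_at \<tau> j" using insert.prems(1) by (auto simp: J_def)
    have "{i \<in> {1..d + 2}. sign_at \<sigma> i \<noteq> sign_at (flip j \<rho>) i} = I"
    proof (intro Set.set_eqI)
      fix i
      have "i \<in> {i \<in> {1..d + 2}. sign_at \<sigma> i \<noteq> sign_at \<rho> i} \<longleftrightarrow> i \<in> insert j I"
        by (simp only: insert.prems(3))
      then show "i \<in> {i \<in> {1..d + 2}. sign_at \<sigma> i \<noteq> sign_at (flip j \<rho>) i} \<longleftrightarrow> i \<in> I"
        using insert.hyps(2) j by (auto simp: sign_at_flip)
    qed
    then have "Q (flip j \<rho>)"
      using insert.prems(1,2) j by (intro insert.IH) (auto intro: flip_transversal)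
    from step[OF _ this j] show ?case
      using insert.prems(2) j by (simp add: flip_transversal)
  qed
  from this[of J \<tau>] show ?thesis using assms(2) by (auto simp: J_def)
qed

text \<open>The set \<open>\<sigma> - {v}\<close> prescribes every sign except the one at
  \<open>idx v\<close>, so a ridge of the cross polytope leaves only two candidates for a facet
  containing it.\<close>

lemma transversal_supersets:
  assumes "\<sigma> \<in> transversals d" "\<tau> \<in> transversals d" "v \<in> \<sigma>" "\<sigma> - {v} \<subseteq> \<tau>"
  shows "\<tau> = \<sigma> \<or> \<tau> = flip (idx v) \<sigma>"
proof -
  have v: "1 \<le> idx v" "idx v \<le> d + 2" using transversal_mem_idx[OF assms(1,3)] by auto
  have eq: "sign_at \<tau> i = sign_at \<sigma> i" if "i \<noteq> idx v" "1 \<le> i" "i \<le> d + 2" for i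
  proof (cases "sign_at \<sigma> i")
    case True
    then have "X i \<in> \<tau>" using that assms(4) by (auto simp: transversal_mem_iff[OF assms(1)])
    then show ?thesis using True by (auto simp: transversal_mem_iff[OF assms(2)])
  next
    case False
    then have "Y i \<in> \<tau>" using that assms(4) by (auto simp: transversal_mem_iff[OF assms(1)])
    then show ?thesis using False by (auto simp: transversal_mem_iff[OF assms(2)])
  qed
  show ?thesis
  proof (cases "sign_at \<tau> (idx v) = sign_at \<sigma> (idx v)")
    case True
    then have "\<tau> = \<sigma>" using eq assms by (intro transversal_eqI[of _ d]) metis+
    then show ?thesis ..
  next
    case False
    then have "\<tau> = flip (idx v) \<sigma>"
      using eq assms v by (intro transversal_eqI[of _ d]) (auto intro: flip_transversal simp: sign_at_flip)
    then show ?thesis ..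
  qed
qed

section \<open>Facets of the Klee--Novik complexes\<close>

text \<open>Distinctness matters: joining \<open>two_points i\<close> twice would create the face
  \<open>{X i, Y i}\<close>.\<close>

lemma foldr_join_two_points:
  "foldr join (map two_points is) {{}} =
     {\<sigma>. (\<forall>v\<in>\<sigma>. idx v \<in> set is) \<and> (\<forall>i\<in>set is. X i \<in> \<sigma> \<longrightarrow> Y i \<notin> \<sigma>)}" (is "_ = ?F is")
  if "distinct is"
  using that
proof (induction "is")
  case Nil
  then show ?case by auto
next
  case (Cons i "is")
  have "join (two_points i) (?F is) = ?F (i # is)"
  proof (intro Set.set_eqI iffI)
    fix \<sigma> assume "\<sigma> \<in> join (two_points i) (?F is)"
    then show "\<sigma> \<in> ?F (i # is)" using Cons.prems
      by (fastforce simp: join_def two_points_def)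
  next
    fix \<sigma> assume \<sigma>: "\<sigma> \<in> ?F (i # is)"
    have "\<sigma> \<inter> {X i, Y i} \<in> two_points i"
      using \<sigma> by (auto simp: two_points_def)
    moreover have "\<sigma> - {X i, Y i} \<in> ?F is"
    proof -
      have "idx v \<in> set is" if "v \<in> \<sigma>" "v \<noteq> X i" "v \<noteq> Y i" for v
        using \<sigma> that by (cases v) auto
      then show ?thesis using \<sigma> by auto
    qed
    moreover have "\<sigma> = (\<sigma> \<inter> {X i, Y i}) \<union> (\<sigma> - {X i, Y i})" by auto
    ultimately show "\<sigma> \<in> join (two_points i) (?F is)" unfolding join_def by blast
  qed
  then show ?case using Cons by simp
qed

lemma cross_polytope_sphere_eq: "cross_polytope_sphere d = spanned_by (transversals d)"
proof -
  have "cross_polytope_sphere d =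
      {\<sigma>. (\<forall>v\<in>\<sigma>. idx v \<in> {1..d + 2}) \<and> (\<forall>i\<in>{1..d + 2}. X i \<in> \<sigma> \<longrightarrow> Y i \<notin> \<sigma>)}"
    unfolding cross_polytope_sphere_def
    by (subst foldr_join_two_points) (auto simp: set_upt less_Suc_eq_le)
  also have "\<dots> = spanned_by (transversals d)"
  proof (intro Set.set_eqI iffI)
    fix \<sigma> assume \<sigma>: "\<sigma> \<in> {\<sigma>. (\<forall>v\<in>\<sigma>. idx v \<in> {1..d + 2}) \<and> (\<forall>i\<in>{1..d + 2}. X i \<in> \<sigma> \<longrightarrow> Y i \<notin> \<sigma>)}"
    \<comment> \<open>Extend the face to a facet; coordinates absent from it receive the sign
      \<open>-\<close> by default.\<close>
    obtain \<tau> where \<tau>: "\<tau> \<in> transversals d"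
      "\<And>i. 1 \<le> i \<Longrightarrow> i \<le> d + 2 \<Longrightarrow> sign_at \<tau> i = (X i \<in> \<sigma>)"
      using transversal_of_signs[of d "\<lambda>i. X i \<in> \<sigma>"] by blast
    have "\<sigma> \<subseteq> \<tau>"
    proof
      fix v assume v: "v \<in> \<sigma>"
      then have "1 \<le> idx v" "idx v \<le> d + 2" using \<sigma> by auto
      with v \<sigma> show "v \<in> \<tau>"
        by (cases v) (auto simp: transversal_mem_iff[OF \<tau>(1)] \<tau>(2))
    qed
    then show "\<sigma> \<in> spanned_by (transversals d)" using \<tau> by (auto simp: spanned_by_def)
  qed (fastforce simp: spanned_by_def transversals_def)
  finally show ?thesis .
qed

text \<open>All transversals have \<open>d + 2\<close> elements, so none properly contains
  another.\<close>

lemma facets_spanned_by: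
  assumes "F \<subseteq> transversals d"
  shows "facets (spanned_by F) = F"
proof -
  have "\<tau> = \<sigma>" if "\<sigma> \<in> F" "\<tau> \<in> F" "\<sigma> \<subseteq> \<tau>" for \<sigma> \<tau>
    using that assms card_transversal[of _ d] finite_transversal[of _ d]
    by (metis card_subset_eq subsetD)
  then show ?thesis by (fastforce simp: facets_def spanned_by_def)
qed

definition few_changes :: "nat \<Rightarrow> nat \<Rightarrow> vertex set set" where
  "few_changes k d = {\<sigma> \<in> transversals d. card (sign_changes d \<sigma>) \<le> k}"

text \<open>The ridges belonging to the edge cut, each written from its inner side.\<close>

definition KN_facets :: "nat \<Rightarrow> nat \<Rightarrow> vertex set set" where
  "KN_facets k d =
     {\<sigma> - {v} | \<sigma> v. \<sigma> \<in> few_changes k d \<and> v \<in> \<sigma> \<and> flip (idx v) \<sigma> \<notin> few_changes k d}"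

lemma few_changes_transversal: "\<sigma> \<in> few_changes k d \<Longrightarrow> \<sigma> \<in> transversals d"
  by (simp add: few_changes_def)

lemma KN_filled_eq: "KN_filled k d = spanned_by (few_changes k d)"
  by (simp add: KN_filled_def cross_polytope_sphere_eq few_changes_def facets_spanned_by[of _ d])

text \<open>Only \<open>\<sigma>\<close> and \<open>flip (idx v) \<sigma>\<close> can contain the
  ridge \<open>\<sigma> - {v}\<close>, so it lies in exactly one facet of the filled complex iff
  that neighbour is missing.\<close>

lemma KN_eq: "KN k d = spanned_by (KN_facets k d)"
proof -
  let ?A = "few_changes k d"
  have fA: "facets (spanned_by ?A) = ?A"
    by (rule facets_spanned_by[of _ d]) (auto simp: few_changes_def)
  have "{\<tau> \<in> spanned_by ?A. card \<tau> = d + 1 \<and> card {\<sigma> \<in> ?A. \<tau> \<subseteq> \<sigma>} = 1} = KN_facets k d" (is "?B = _")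
  proof (intro Set.set_eqI iffI)
    have sup: "{\<rho> \<in> ?A. \<sigma> - {v} \<subseteq> \<rho>} = {\<sigma>, flip (idx v) \<sigma>} \<inter> ?A" if "\<sigma> \<in> ?A" "v \<in> \<sigma>" for \<sigma> v
    proof -
      have "\<sigma> - {v} \<subseteq> flip (idx v) \<sigma>"
      proof
        fix u assume "u \<in> \<sigma> - {v}"
        moreover from this have "idx u \<noteq> idx v"
          using that few_changes_transversal[OF that(1)] transversal_opp[of \<sigma> d v]
            transversal_mem_idx[of \<sigma> d v] by (auto simp: idx_eq_iff)
        ultimately show "u \<in> flip (idx v) \<sigma>" by (simp add: mem_flip)
      qed
      then show ?thesis
        using transversal_supersets[of \<sigma> d _ v] that few_changes_transversal by blast
    qed
    {
      fix \<tau> assume \<tau>: "\<tau> \<in> ?B"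
      then obtain \<sigma> where \<sigma>: "\<sigma> \<in> ?A" "\<tau> \<subseteq> \<sigma>" by (auto simp: spanned_by_def)
      have \<sigma>T: "\<sigma> \<in> transversals d" using \<sigma> few_changes_transversal by auto
      have "card (\<sigma> - \<tau>) = 1"
        using \<sigma> \<tau> card_transversal[OF \<sigma>T] finite_transversal[OF \<sigma>T] by (subst card_Diff_subset) (auto intro: finite_subset)
      then obtain v where "\<sigma> - \<tau> = {v}" by (auto simp: card_1_singleton_iff)
      then have v: "v \<in> \<sigma>" "\<tau> = \<sigma> - {v}" using \<sigma> by auto
      have "flip (idx v) \<sigma> \<notin> ?A"
      proof
        assume "flip (idx v) \<sigma> \<in> ?A"
        then have "{\<rho> \<in> ?A. \<tau> \<subseteq> \<rho>} = {\<sigma>, flip (idx v) \<sigma>}" using sup[OF \<sigma>(1) v(1)] v(2) \<sigma>(1) by auto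
        moreover have "card {\<sigma>, flip (idx v) \<sigma>} = 2" by (metis card_2_iff flip_neq)
        ultimately show False using \<tau> by auto
      qed
      then show "\<tau> \<in> KN_facets k d" using \<sigma> v by (auto simp: KN_facets_def)
    }
    {
      fix \<tau> assume "\<tau> \<in> KN_facets k d"
      then obtain \<sigma> v where \<sigma>: "\<sigma> \<in> ?A" "v \<in> \<sigma>" "\<tau> = \<sigma> - {v}" "flip (idx v) \<sigma> \<notin> ?A"
        by (auto simp: KN_facets_def)
      have "card \<tau> = d + 1"
        using \<sigma> card_transversal[of \<sigma> d] few_changes_transversal[OF \<sigma>(1)] by simp
      moreover have "{\<rho> \<in> ?A. \<tau> \<subseteq> \<rho>} = {\<sigma>}" using sup \<sigma> by auto
      ultimately show "\<tau> \<in> ?B" using \<sigma> by (auto simp: spanned_by_def)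
    }
  qed
  then show ?thesis
    by (simp add: KN_def boundary_complex_def KN_filled_eq fA)
qed

lemma card_KN_facet: "\<tau> \<in> KN_facets k d \<Longrightarrow> card \<tau> = d + 1"
  using card_transversal few_changes_transversal by (fastforce simp: KN_facets_def)

lemma KN_facetI:
  assumes "\<tau> \<in> KN k d" "card \<tau> = d + 1"
  shows "\<tau> \<in> KN_facets k d"
proof -
  obtain \<rho> where "\<rho> \<in> KN_facets k d" "\<tau> \<subseteq> \<rho>" using assms by (auto simp: KN_eq spanned_by_def)
  with card_KN_facet[OF this(1)] assms(2) show ?thesis
    by (metis card.infinite card_subset_eq add_is_0 zero_neq_one)
qed

lemma KN_no_opp:
  assumes "\<tau> \<in> KN k d" "v \<in> \<tau>"
  shows "opp v \<notin> \<tau>"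
proof -
  obtain \<sigma> where "\<sigma> \<in> transversals d" "\<tau> \<subseteq> \<sigma>"
    using assms(1) few_changes_transversal by (fastforce simp: KN_eq spanned_by_def KN_facets_def)
  then show ?thesis using transversal_opp[of \<sigma> d v] transversal_mem_idx[of \<sigma> d v] assms(2) by auto
qed

section \<open>Sign changes\<close>

text \<open>The gaps on both sides of coordinate \<open>i\<close>, where gap \<open>j\<close> lies
  between \<open>j\<close> and \<open>j + 1\<close>. The intersection discards the side that does
  not exist at the ends \<open>1\<close> and \<open>d + 2\<close>.\<close>

definition walls :: "nat \<Rightarrow> nat \<Rightarrow> nat set" where
  "walls d i = {i - 1, i} \<inter> {1..d + 1}"

lemma sign_changes_subset: "sign_changes d \<sigma> \<subseteq> {1..d + 1}"
  by (auto simp: sign_changes_def)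

lemma finite_sign_changes [simp]: "finite (sign_changes d \<sigma>)"
  using finite_subset[OF sign_changes_subset] by blast

lemma finite_walls [simp]: "finite (walls d i)"
  by (simp add: walls_def)

lemma card_walls_le: "card (walls d i) \<le> 2"
proof -
  have "card (walls d i) \<le> card {i - 1, i}" unfolding walls_def by (intro card_mono) auto
  also have "\<dots> \<le> 2" by (simp add: card_insert_if)
  finally show ?thesis .
qed

lemma card_sym_diff_le: "finite A \<Longrightarrow> finite B \<Longrightarrow> card (sym_diff A B) \<le> card A + card B"
  by (meson card_Un_le card_mono Diff_subset add_mono order_trans)

lemma sign_changes_flip:
  assumes "1 \<le> i"
  shows "sign_changes d (flip i \<sigma>) = sym_diff (sign_changes d \<sigma>) (walls d i)"
  using assms by (auto simp: sign_changes_def walls_def sign_at_flip)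

text \<open>The signs are the prefix parities of \<open>C\<close>, starting with \<open>+\<close> in
  position 1.\<close>

lemma transversal_of_changes:
  assumes "C \<subseteq> {1..d + 1}"
  obtains \<sigma> where "\<sigma> \<in> transversals d" "sign_changes d \<sigma> = C"
proof -
  obtain \<sigma> where \<sigma>: "\<sigma> \<in> transversals d"
    "\<And>i. 1 \<le> i \<Longrightarrow> i \<le> d + 2 \<Longrightarrow> sign_at \<sigma> i = even (card (C \<inter> {..<i}))"
    using transversal_of_signs[of d "\<lambda>i. even (card (C \<inter> {..<i}))"] by blast
  have "i \<in> sign_changes d \<sigma> \<longleftrightarrow> i \<in> C" if "1 \<le> i" "i \<le> d + 1" for i
  proof -
    have "C \<inter> {..<Suc i} = (if i \<in> C then insert i (C \<inter> {..<i}) else C \<inter> {..<i})"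
      by (auto simp: less_Suc_eq)
    then show ?thesis using that by (auto simp: sign_changes_def \<sigma>(2))
  qed
  then have "sign_changes d \<sigma> = C" using assms sign_changes_subset[of d \<sigma>] by auto
  with \<sigma>(1) that show thesis by blast
qed

lemma sign_changes_eq_empty_iff:
  "sign_changes d \<sigma> = {} \<longleftrightarrow> (\<forall>i\<in>{1..d + 2}. sign_at \<sigma> i = sign_at \<sigma> 1)"
proof
  assume *: "sign_changes d \<sigma> = {}"
  have "sign_at \<sigma> i = sign_at \<sigma> 1" if "1 \<le> i" "i \<le> d + 2" for i
    using that
  proof (induction i rule: dec_induct)
    case (step i)
    then have "i \<notin> sign_changes d \<sigma> \<and> i \<in> {1..d + 1}" using * by auto
    then show ?case using step by (auto simp: sign_changes_def)
  qed simp
  then show "\<forall>i\<in>{1..d + 2}. sign_at \<sigma> i = sign_at \<sigma> 1" by (meson atLeastAtMost_iff)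
next
  assume *: "\<forall>i\<in>{1..d + 2}. sign_at \<sigma> i = sign_at \<sigma> 1"
  have "i \<notin> sign_changes d \<sigma>" for i
    using bspec[OF *, of i] bspec[OF *, of "i + 1"] by (auto simp: sign_changes_def)
  then show "sign_changes d \<sigma> = {}" by blast
qed

text \<open>Flipping inside a run of equal signs creates two new changes, and long sequences with few
  changes have such runs.\<close>

lemma few_changes_interior:
  assumes "2 * (c + 2) < d"
  shows "few_changes c d =
    {\<sigma> \<in> few_changes (c + 2) d. \<forall>i\<in>{1..d + 2}. flip i \<sigma> \<in> few_changes (c + 2) d}"
proof (intro Set.set_eqI iffI)
  fix \<sigma> assume \<sigma>: "\<sigma> \<in> few_changes c d"
  have "card (sign_changes d (flip i \<sigma>)) \<le> c + 2" if "1 \<le> i" for i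
    unfolding sign_changes_flip[OF that]
    using card_sym_diff_le[of "sign_changes d \<sigma>" "walls d i"] card_walls_le[of d i] \<sigma>
    by (auto simp: few_changes_def)
  then show "\<sigma> \<in> {\<sigma> \<in> few_changes (c + 2) d. \<forall>i\<in>{1..d + 2}. flip i \<sigma> \<in> few_changes (c + 2) d}"
    using \<sigma> by (auto simp: few_changes_def flip_transversal)
next
  fix \<sigma> assume \<sigma>: "\<sigma> \<in> {\<sigma> \<in> few_changes (c + 2) d. \<forall>i\<in>{1..d + 2}. flip i \<sigma> \<in> few_changes (c + 2) d}"
  let ?S = "sign_changes d \<sigma>"
  \<comment> \<open>An interior coordinate \<open>i\<close> borders a change iff \<open>i\<close> or
    \<open>i - 1\<close> is in \<open>?S\<close>, that is, iff it lies in this union, which is too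
    small to cover all \<open>d\<close> interior coordinates.\<close>
  have "card (?S \<union> Suc ` ?S) \<le> 2 * (c + 2)"
    using \<sigma> card_Un_le[of ?S "Suc ` ?S"] by (auto simp: few_changes_def card_image)
  moreover have "card {2..d + 1} = d" by simp
  ultimately have "\<not> {2..d + 1} \<subseteq> ?S \<union> Suc ` ?S"
    using assms card_mono[of "?S \<union> Suc ` ?S" "{2..d + 1}"] by auto
  then obtain i where "i \<in> {2..d + 1}" "i \<notin> ?S \<union> Suc ` ?S" by blast
  then have i: "2 \<le> i" "i \<le> d + 1" "i \<notin> ?S" "i \<notin> Suc ` ?S" by simp_all
  have i1: "i - 1 \<notin> ?S"
  proof
    assume "i - 1 \<in> ?S"
    then have "Suc (i - 1) \<in> Suc ` ?S" by blast
    with i show False by simp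
  qed
  have "walls d i = {i - 1, i}" using i by (auto simp: walls_def)
  then have "sign_changes d (flip i \<sigma>) = insert (i - 1) (insert i ?S)"
    using i i1 by (subst sign_changes_flip) auto
  then have "card (sign_changes d (flip i \<sigma>)) = card ?S + 2"
    using i i1 by (auto simp: card_insert_if)
  moreover have "flip i \<sigma> \<in> few_changes (c + 2) d" using \<sigma> i by simp
  ultimately show "\<sigma> \<in> few_changes c d" using \<sigma> by (simp add: few_changes_def)
qed

section \<open>Signed permutations\<close>

text \<open>The hyperoctahedral group: \<open>idx (p (X i))\<close> is the underlying permutation of
  the coordinates, and the constructor of \<open>p (X i)\<close> is the sign.\<close>

definition signed_perm :: "nat \<Rightarrow> (vertex \<Rightarrow> vertex) \<Rightarrow> bool" where
  "signed_perm d p \<longleftrightarrow> p permutes polytope_vertices d \<and> (\<forall>v. p (opp v) = opp (p v))"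

lemma signed_perm_opp: "signed_perm d p \<Longrightarrow> p (opp v) = opp (p v)"
  by (simp add: signed_perm_def)

lemma signed_perm_Y: "signed_perm d p \<Longrightarrow> p (Y i) = opp (p (X i))"
  using signed_perm_opp[of d p "X i"] by simp

lemma signed_perm_inj: "signed_perm d p \<Longrightarrow> inj p"
  unfolding signed_perm_def by (blast intro: permutes_inj)

lemma signed_perm_idx:
  assumes "signed_perm d p"
  shows "1 \<le> idx (p v) \<and> idx (p v) \<le> d + 2 \<longleftrightarrow> 1 \<le> idx v \<and> idx v \<le> d + 2"
  using assms permutes_in_image[of p "polytope_vertices d" v] by (simp add: signed_perm_def)

lemma signed_perm_comp: "signed_perm d p \<Longrightarrow> signed_perm d q \<Longrightarrow> signed_perm d (p \<circ> q)"
  by (auto simp: signed_perm_def intro: permutes_compose)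

lemma signed_perm_id: "signed_perm d id"
  by (auto simp: signed_perm_def permutes_id)

lemma signed_perm_inv:
  assumes "signed_perm d p"
  shows "signed_perm d (inv_into UNIV p)"
proof -
  have "bij p" using assms unfolding signed_perm_def by (blast intro: permutes_bij)
  then have "inv_into UNIV p (opp v) = opp (inv_into UNIV p v)" for v
    using signed_perm_opp[OF assms, of "inv_into UNIV p v"] by (metis bij_inv_eq_iff)
  then show ?thesis using assms by (simp add: signed_perm_def permutes_inv)
qed

lemma signed_perm_transversal:
  assumes "signed_perm d p" "\<sigma> \<in> transversals d"
  shows "p ` \<sigma> \<in> transversals d"
proof -
  have "Y i \<in> p ` \<sigma> \<longleftrightarrow> X i \<notin> p ` \<sigma>" if "i \<in> {1..d + 2}" for i
  proof -
    have "bij p" using assms unfolding signed_perm_def by (blast intro: permutes_bij)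
    then obtain v where v: "p v = X i" by (metis bij_pointE)
    then have "p (opp v) = Y i" using signed_perm_opp[OF assms(1)] by simp
    then have "X i \<in> p ` \<sigma> \<longleftrightarrow> v \<in> \<sigma>" "Y i \<in> p ` \<sigma> \<longleftrightarrow> opp v \<in> \<sigma>"
      using v signed_perm_inj[OF assms(1)] by (metis inj_image_mem_iff)+
    moreover have "1 \<le> idx v \<and> idx v \<le> d + 2"
      using signed_perm_idx[OF assms(1), of v] v that by auto
    ultimately show ?thesis using transversal_opp[OF assms(2), of v] by auto
  qed
  moreover have "p ` \<sigma> \<subseteq> polytope_vertices d"
    using transversal_mem_idx[OF assms(2)] signed_perm_idx[OF assms(1)] by auto
  ultimately show ?thesis by (simp add: transversals_def)
qed

text \<open>Antipodal pairs go to antipodal pairs, so \<open>p\<close> acts on the cube as a graph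
  automorphism and only relabels the directions of flips.\<close>

lemma signed_perm_flip:
  assumes "signed_perm d p"
  shows "p ` flip i \<sigma> = flip (idx (p (X i))) (p ` \<sigma>)"
proof -
  have "p ` {X i, Y i} = {X (idx (p (X i))), Y (idx (p (X i)))}"
    using signed_perm_Y[OF assms] by (simp add: pair_idx)
  then show ?thesis
    using signed_perm_inj[OF assms] unfolding flip_def by (metis image_Un image_set_diff)
qed

lemma signed_perm_idx_X: "signed_perm d p \<Longrightarrow> idx (p (X (idx v))) = idx (p v)"
  by (cases v) (auto simp: signed_perm_Y)

text \<open>An injective self-map of a finite set is onto. Thus invariance in one direction also
  gives invariance of the complement.\<close>

lemma signed_perm_maps_onto:
  assumes "signed_perm d p" "\<And>\<sigma>. \<sigma> \<in> A \<Longrightarrow> p ` \<sigma> \<in> A" "finite A"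
  shows "p ` \<sigma> \<in> A \<longleftrightarrow> \<sigma> \<in> A"
proof -
  have inj: "inj ((`) p)" using signed_perm_inj[OF assms(1)] by (simp add: inj_def inj_image_eq_iff)
  have "(`) p ` A = A"
    by (rule endo_inj_surj) (use assms inj in \<open>auto intro: inj_on_subset\<close>)
  then show ?thesis using inj by (metis inj_image_mem_iff)
qed

text \<open>The outside of \<open>few_changes k d\<close> is preserved along with the inside, so
  edges of the cut go to edges of the cut.\<close>

lemma signed_perm_maps_KN:
  assumes p: "signed_perm d p" and A: "\<And>\<sigma>. \<sigma> \<in> few_changes k d \<Longrightarrow> p ` \<sigma> \<in> few_changes k d"
    and "\<tau> \<in> KN k d"
  shows "p ` \<tau> \<in> KN k d"
proof -
  obtain \<sigma> v where \<sigma>: "\<sigma> \<in> few_changes k d" "v \<in> \<sigma>" "flip (idx v) \<sigma> \<notin> few_changes k d" "\<tau> \<subseteq> \<sigma> - {v}"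
    using assms(3) by (auto simp: KN_eq spanned_by_def KN_facets_def)
  have "finite (few_changes k d)" by (simp add: few_changes_def)
  from signed_perm_maps_onto[OF p A this]
  have "p ` flip (idx v) \<sigma> \<notin> few_changes k d" using \<sigma>(3) by simp
  then have "flip (idx (p v)) (p ` \<sigma>) \<notin> few_changes k d"
    by (simp add: signed_perm_flip[OF p] signed_perm_idx_X[OF p])
  then have "p ` \<sigma> - {p v} \<in> KN_facets k d" unfolding KN_facets_def using A \<sigma> by blast
  moreover have "p ` \<tau> \<subseteq> p ` \<sigma> - {p v}" using \<sigma>(4) signed_perm_inj[OF p] by (auto dest: injD)
  ultimately show ?thesis by (auto simp: KN_eq spanned_by_def)
qed

section \<open>Automorphisms act on the cross polytope\<close>

lemma transversal_mem:
  assumes "\<sigma> \<in> transversals d" "1 \<le> idx v" "idx v \<le> d + 2"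
  shows "v \<in> \<sigma> \<longleftrightarrow> (sign_at \<sigma> (idx v) \<longleftrightarrow> v = X (idx v))"
  using assms(2,3) by (cases v) (auto simp: transversal_mem_iff[OF assms(1)])

text \<open>Walk from a sequence with at most one change to one with at least \<open>d\<close> changes.\<close>

lemma non_antipodal_pair_in_KN:
  assumes "1 \<le> k" "k < d" "u \<in> polytope_vertices d" "v \<in> polytope_vertices d" "v \<noteq> opp u"
  shows "{u, v} \<in> KN k d"
proof -
  have *: "{u, v} \<in> KN k d" if uv: "u \<in> polytope_vertices d" "v \<in> polytope_vertices d" "v \<noteq> opp u"
    and le: "idx u \<le> idx v" for u v
  proof (rule ccontr)
    assume not: "{u, v} \<notin> KN k d"
    define a b s t where "a = idx u" and "b = idx v" and "s \<longleftrightarrow> u = X (idx u)" and "t \<longleftrightarrow> v = X (idx v)"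
    have ab: "1 \<le> a" "a \<le> b" "b \<le> d + 2" using uv le by (auto simp: a_def b_def)
    have st: "a = b \<Longrightarrow> s = t"
      using uv(3) by (cases u; cases v) (auto simp: a_def b_def s_def t_def)
    \<comment> \<open>Both sequences pass through \<open>u\<close> and \<open>v\<close>:
      \<open>\<sigma>\<close> is constant before \<open>b\<close> and from \<open>b\<close> on,
      while \<open>\<tau>\<close> alternates on both pieces. Only at the gap \<open>b - 1\<close>
      can \<open>\<sigma>\<close> change or \<open>\<tau>\<close> fail to. For \<open>a = b\<close>
      the prescriptions agree because the pair is not antipodal.\<close>
    obtain \<sigma> where \<sigma>: "\<sigma> \<in> transversals d"
      "\<And>i. 1 \<le> i \<Longrightarrow> i \<le> d + 2 \<Longrightarrow> sign_at \<sigma> i = (if i < b then s else t)"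
      using transversal_of_signs[of d "\<lambda>i. if i < b then s else t"] by blast
    obtain \<tau> where \<tau>: "\<tau> \<in> transversals d"
      "\<And>i. 1 \<le> i \<Longrightarrow> i \<le> d + 2 \<Longrightarrow> sign_at \<tau> i =
        (if i < b then s = (even i = even a) else t = (even i = even b))"
      using transversal_of_signs[of d "\<lambda>i. if i < b then s = (even i = even a) else t = (even i = even b)"]
      by blast
    have mem: "u \<in> \<rho>" "v \<in> \<rho>" if "\<rho> \<in> transversals d" "sign_at \<rho> a = s" "sign_at \<rho> b = t" for \<rho>
      using that uv by (auto simp: transversal_mem a_def b_def s_def t_def)
    have sg: "sign_at \<sigma> a = s" "sign_at \<sigma> b = t" "sign_at \<tau> a = s" "sign_at \<tau> b = t"
      using ab st by (cases "a = b"; simp add: \<sigma>(2) \<tau>(2))+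
    then have u1: "u \<in> \<sigma>" "v \<in> \<sigma>" "u \<in> \<tau>" "v \<in> \<tau>"
      using mem \<sigma>(1) \<tau>(1) by blast+
    have "sign_changes d \<sigma> \<subseteq> {b - 1}" by (auto simp: sign_changes_def \<sigma>(2) split: if_splits)
    then have "card (sign_changes d \<sigma>) \<le> card {b - 1}" by (intro card_mono) auto
    then have \<sigma>A: "\<sigma> \<in> few_changes k d" using assms \<sigma> by (simp add: few_changes_def)
    have "{1..d + 1} - {b - 1} \<subseteq> sign_changes d \<tau>" by (auto simp: sign_changes_def \<tau>(2) split: if_splits)
    then have "card ({1..d + 1} - {b - 1}) \<le> card (sign_changes d \<tau>)" by (intro card_mono) auto
    moreover have "card {1..d + 1} - card {b - 1} \<le> card ({1..d + 1} - {b - 1})" by (rule diff_card_le_card_Diff) simp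
    ultimately have \<tau>A: "\<tau> \<notin> few_changes k d" using assms by (simp add: few_changes_def)
    have "\<tau> \<in> few_changes k d \<and> u \<in> \<tau> \<and> v \<in> \<tau>"
    proof (rule flip_connected[OF \<sigma>(1) \<tau>(1)])
      show "\<sigma> \<in> few_changes k d \<and> u \<in> \<sigma> \<and> v \<in> \<sigma>" using \<sigma>A u1 by simp
    next
      fix \<rho> j
      assume \<rho>: "\<rho> \<in> transversals d" "\<rho> \<in> few_changes k d \<and> u \<in> \<rho> \<and> v \<in> \<rho>"
        and j: "1 \<le> j" "j \<le> d + 2" "sign_at \<sigma> j \<noteq> sign_at \<tau> j"
      have ne: "j \<noteq> a" "j \<noteq> b" using j(3) sg by auto
      obtain w where w: "w \<in> \<rho>" "idx w = j"
        using transversal_mem_iff[OF \<rho>(1), of j] j by (metis atLeastAtMost_iff idx.simps)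
      \<comment> \<open>Otherwise the walk would leave \<open>few_changes k d\<close> through a
        ridge containing \<open>u\<close> and \<open>v\<close>, since the coordinates
        \<open>a\<close> and \<open>b\<close> are never flipped.\<close>
      have "flip (idx w) \<rho> \<in> few_changes k d"
      proof (rule ccontr)
        assume "flip (idx w) \<rho> \<notin> few_changes k d"
        then have "\<rho> - {w} \<in> KN_facets k d" using \<rho> w unfolding KN_facets_def by blast
        moreover have "{u, v} \<subseteq> \<rho> - {w}" using \<rho> w ne by (auto simp: a_def b_def)
        ultimately show False using not by (auto simp: KN_eq spanned_by_def)
      qed
      then show "flip j \<rho> \<in> few_changes k d \<and> u \<in> flip j \<rho> \<and> v \<in> flip j \<rho>"
        using \<rho> w ne by (auto simp: mem_flip a_def b_def)
    qed
    with \<tau>A show False by simp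
  qed
  show ?thesis
  proof (cases "idx u \<le> idx v")
    case False
    then have "{v, u} \<in> KN k d" using assms by (intro *) auto
    then show ?thesis by (simp add: insert_commute)
  qed (use assms * in blast)
qed

lemma vertices_KN:
  assumes "1 \<le> k" "k < d"
  shows "vertices (KN k d) = polytope_vertices d"
proof
  show "vertices (KN k d) \<subseteq> polytope_vertices d"
    using few_changes_transversal
    by (fastforce simp: vertices_def KN_eq spanned_by_def KN_facets_def dest: transversal_mem_idx)
  show "polytope_vertices d \<subseteq> vertices (KN k d)"
  proof
    fix v assume "v \<in> polytope_vertices d"
    then have "{v, v} \<in> KN k d" using assms by (intro non_antipodal_pair_in_KN) auto
    then show "v \<in> vertices (KN k d)" by (auto simp: vertices_def)
  qed
qed

lemma finite_KN: "finite (KN k d)"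
proof (rule finite_subset)
  show "KN k d \<subseteq> Pow (polytope_vertices d)"
    using few_changes_transversal
    by (fastforce simp: KN_eq spanned_by_def KN_facets_def dest: transversal_mem_idx)
qed simp

text \<open>Antipodes are visible in the complex: \<open>opp u\<close> is the only vertex that forms
  no face with \<open>u\<close>. The vertex sent to \<open>opp (p u)\<close> forms no face with
  \<open>u\<close>, because its image with \<open>p u\<close> would be an antipodal pair; so it is
  \<open>opp u\<close>.\<close>

lemma automorphism_signed_perm:
  assumes "1 \<le> k" "k < d" "p \<in> carrier (automorphism_group (KN k d))"
  shows "signed_perm d p"
proof -
  have p: "p permutes polytope_vertices d" "\<And>\<tau>. \<tau> \<in> KN k d \<Longrightarrow> p ` \<tau> \<in> KN k d"
    using assms(3) by (auto simp: automorphism_group_def vertices_KN[OF assms(1,2)])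
  have "p (opp u) = opp (p u)" for u
  proof (cases "u \<in> polytope_vertices d")
    case False
    then show ?thesis using p(1) by (simp add: permutes_not_in)
  next
    case True
    then have "opp (p u) \<in> polytope_vertices d"
      using permutes_in_image[OF p(1), of u] by simp
    then obtain w where w: "w \<in> polytope_vertices d" "p w = opp (p u)"
      using permutes_image[OF p(1)] by (metis imageE)
    have "w = opp u"
    proof (rule ccontr)
      assume "w \<noteq> opp u"
      then have "p ` {u, w} \<in> KN k d" using assms True w by (intro p(2) non_antipodal_pair_in_KN) auto
      then show False using KN_no_opp[of "p ` {u, w}" k d "p u"] w by auto
    qed
    then show ?thesis using w by simp
  qed
  with p(1) show ?thesis by (simp add: signed_perm_def)
qed

text \<open>An edge of the cube is cut iff the corresponding ridge is a face of the complex, and by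
  finiteness \<open>p\<close> preserves faces in both directions.\<close>

lemma automorphism_preserves_cut:
  assumes "1 \<le> k" "k < d" "p \<in> carrier (automorphism_group (KN k d))"
    and "\<sigma> \<in> transversals d" "1 \<le> i" "i \<le> d + 2"
  shows "(p ` \<sigma> \<in> few_changes k d \<longleftrightarrow> p ` flip i \<sigma> \<in> few_changes k d) \<longleftrightarrow>
    (\<sigma> \<in> few_changes k d \<longleftrightarrow> flip i \<sigma> \<in> few_changes k d)"
proof -
  have p: "signed_perm d p" using automorphism_signed_perm[OF assms(1-3)] .
  have face_iff: "\<sigma> - {v} \<in> KN k d \<longleftrightarrow> (\<sigma> \<in> few_changes k d) \<noteq> (flip (idx v) \<sigma> \<in> few_changes k d)"
    if \<sigma>: "\<sigma> \<in> transversals d" "v \<in> \<sigma>" for \<sigma> v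
  proof
    assume *: "\<sigma> - {v} \<in> KN k d"
    have "card (\<sigma> - {v}) = d + 1" using that card_transversal[of \<sigma> d] by simp
    from KN_facetI[OF * this] obtain \<tau> w where \<tau>: "\<tau> \<in> few_changes k d" "w \<in> \<tau>" "\<sigma> - {v} = \<tau> - {w}"
      "flip (idx w) \<tau> \<notin> few_changes k d" by (auto simp: KN_facets_def)
    have \<tau>T: "\<tau> \<in> transversals d" using \<tau> few_changes_transversal by blast
    \<comment> \<open>The ridge may have been recorded from either of its two sides.\<close>
    have "\<tau> = \<sigma> \<or> \<tau> = flip (idx v) \<sigma>" using transversal_supersets[OF that(1) \<tau>T that(2)] \<tau> by auto
    moreover have "\<sigma> = \<tau> \<or> \<sigma> = flip (idx w) \<tau>" using transversal_supersets[OF \<tau>T that(1) \<tau>(2)] \<tau> by auto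
    moreover have "v = w" if "\<sigma> = \<tau>" using \<sigma>(2) \<tau>(2,3) that by blast
    ultimately show "(\<sigma> \<in> few_changes k d) \<noteq> (flip (idx v) \<sigma> \<in> few_changes k d)"
      using \<tau> flip_neq by metis
  next
    assume *: "(\<sigma> \<in> few_changes k d) \<noteq> (flip (idx v) \<sigma> \<in> few_changes k d)"
    have v: "1 \<le> idx v" "idx v \<le> d + 2" using transversal_mem_idx[OF that] by auto
    have "\<sigma> - {v} \<in> KN_facets k d"
    proof (cases "\<sigma> \<in> few_changes k d")
      case True
      then show ?thesis using * that by (auto simp: KN_facets_def)
    next
      case False
      then have "flip (idx v) \<sigma> \<in> few_changes k d" "flip (idx (opp v)) (flip (idx v) \<sigma>) \<notin> few_changes k d"
        using * by auto
      moreover have "opp v \<in> flip (idx v) \<sigma>"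
        using transversal_opp[OF that(1) v] that(2) by (simp add: mem_flip)
      \<comment> \<open>The same ridge seen from the other side, which is the inner one
        here.\<close>
      moreover have "\<sigma> - {v} = flip (idx v) \<sigma> - {opp v}"
        using transversal_opp[OF that(1) v] that(2) by (auto simp: mem_flip idx_eq_iff)
      ultimately show ?thesis unfolding KN_facets_def by blast
    qed
    then show "\<sigma> - {v} \<in> KN k d" by (auto simp: KN_eq spanned_by_def)
  qed
  have "\<And>\<tau>. \<tau> \<in> KN k d \<Longrightarrow> p ` \<tau> \<in> KN k d"
    using assms(3) by (auto simp: automorphism_group_def)
  from signed_perm_maps_onto[OF p this finite_KN]
  have KN_iff: "p ` \<tau> \<in> KN k d \<longleftrightarrow> \<tau> \<in> KN k d" for \<tau> by blast
  obtain v where v: "v \<in> \<sigma>" "idx v = i"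
    using transversal_mem_iff[OF assms(4), of i] assms(5,6) by (metis atLeastAtMost_iff idx.simps)
  have "p ` (\<sigma> - {v}) = p ` \<sigma> - {p v}" using signed_perm_inj[OF p] by (simp add: image_set_diff)
  then have "p ` \<sigma> - {p v} \<in> KN k d \<longleftrightarrow> \<sigma> - {v} \<in> KN k d" using KN_iff[of "\<sigma> - {v}"] by simp
  moreover have "p ` flip i \<sigma> = flip (idx (p v)) (p ` \<sigma>)"
    using v by (auto simp: signed_perm_flip[OF p] signed_perm_idx_X[OF p])
  ultimately show ?thesis
    using face_iff[OF assms(4) v(1)] face_iff[of "p ` \<sigma>" "p v"] v
      signed_perm_transversal[OF p assms(4)] by auto
qed

text \<open>Multiplication by an alternating sign sequence; changes and non-changes trade
  places.\<close>

definition alternate :: "nat \<Rightarrow> vertex \<Rightarrow> vertex" where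
  "alternate d v = (if v \<in> polytope_vertices d \<and> even (idx v) then opp v else v)"

lemma signed_perm_alternate: "signed_perm d (alternate d)"
proof -
  have "alternate d permutes polytope_vertices d"
    by (rule bij_imp_permutes, rule bij_betw_byWitness[of _ "alternate d"]) (auto simp: alternate_def)
  then show ?thesis by (auto simp: signed_perm_def alternate_def)
qed

lemma sign_changes_alternate:
  assumes "\<sigma> \<in> transversals d"
  shows "sign_changes d (alternate d ` \<sigma>) = {1..d + 1} - sign_changes d \<sigma>"
proof -
  have "sign_at (alternate d ` \<sigma>) i \<longleftrightarrow> (sign_at \<sigma> i \<longleftrightarrow> odd i)" if "1 \<le> i" "i \<le> d + 2" for i
  proof -
    have "X i = alternate d (if even i then Y i else X i)" using that by (simp add: alternate_def)
    then have "X i \<in> alternate d ` \<sigma> \<longleftrightarrow> (if even i then Y i else X i) \<in> \<sigma>"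
      by (metis inj_image_mem_iff signed_perm_alternate signed_perm_inj)
    then show ?thesis using transversal_mem_iff[OF assms, of i] that by (auto simp: sign_at_def)
  qed
  then show ?thesis by (auto simp: sign_changes_def)
qed

text \<open>By connectedness of the cube, an automorphism either preserves \<open>few_changes k d\<close> or exchanges it
  with its complement; alternating the signs shows that the complement is larger.\<close>

lemma automorphism_preserves_few_changes:
  assumes "1 \<le> k" "2 * k + 1 \<le> d" "p \<in> carrier (automorphism_group (KN k d))" "\<sigma> \<in> few_changes k d"
  shows "p ` \<sigma> \<in> few_changes k d"
proof (rule ccontr)
  let ?A = "few_changes k d" and ?T = "transversals d"
  assume not: "p ` \<sigma> \<notin> ?A"
  have kd: "k < d" using assms by simp
  have \<sigma>T: "\<sigma> \<in> ?T" using assms few_changes_transversal by blast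
  have p: "signed_perm d p" using automorphism_signed_perm[OF assms(1) kd assms(3)] .
  have swap: "p ` \<tau> \<in> ?A \<longleftrightarrow> \<tau> \<notin> ?A" if "\<tau> \<in> ?T" for \<tau>
  proof (rule flip_connected[OF \<sigma>T that])
    show "p ` \<sigma> \<in> ?A \<longleftrightarrow> \<sigma> \<notin> ?A" using not assms(4) by simp
    show "p ` flip j \<rho> \<in> ?A \<longleftrightarrow> flip j \<rho> \<notin> ?A"
      if "\<rho> \<in> ?T" "p ` \<rho> \<in> ?A \<longleftrightarrow> \<rho> \<notin> ?A" "1 \<le> j" "j \<le> d + 2" for \<rho> j
      using automorphism_preserves_cut[OF assms(1) kd assms(3) that(1,3,4)] that(2) by blast
  qed
  have inj_img: "inj_on ((`) q) S" if "signed_perm d q" for q and S :: "vertex set set"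
    using signed_perm_inj[OF that] by (simp add: inj_on_def inj_image_eq_iff)
  let ?a = "alternate d"
  have fin: "finite ?A" "finite (?T - ?A)" by (auto simp: few_changes_def)
  \<comment> \<open>A witness for strictness: \<open>k + 1\<close> changes put it outside
    \<open>few_changes k d\<close>, but alternated members of that set have at least
    \<open>d + 1 - k\<close>, hence at least \<open>k + 2\<close>, changes.\<close>
  have "{1..k + 1} \<subseteq> {1..d + 1}" using kd by auto
  then obtain \<tau> where \<tau>: "\<tau> \<in> ?T" "sign_changes d \<tau> = {1..k + 1}" using transversal_of_changes by metis
  have aA: "?a ` \<rho> \<in> ?T - ?A" if "\<rho> \<in> ?A" for \<rho>
  proof -
    have \<rho>: "\<rho> \<in> ?T" "card (sign_changes d \<rho>) \<le> k" using that by (auto simp: few_changes_def)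
    have "card (sign_changes d (?a ` \<rho>)) = d + 1 - card (sign_changes d \<rho>)"
      unfolding sign_changes_alternate[OF \<rho>(1)]
      using card_Diff_subset[OF finite_sign_changes sign_changes_subset, of d \<rho>] by simp
    then show ?thesis using \<rho> assms signed_perm_transversal[OF signed_perm_alternate \<rho>(1)]
      by (auto simp: few_changes_def)
  qed
  have "\<tau> \<in> (?T - ?A) - (`) ?a ` ?A"
  proof -
    have "\<tau> \<noteq> ?a ` \<rho>" if "\<rho> \<in> ?A" for \<rho>
    proof
      assume eq: "\<tau> = ?a ` \<rho>"
      have \<rho>: "\<rho> \<in> ?T" "card (sign_changes d \<rho>) \<le> k" using that by (auto simp: few_changes_def)
      have "card (sign_changes d (?a ` \<rho>)) = d + 1 - card (sign_changes d \<rho>)"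
        unfolding sign_changes_alternate[OF \<rho>(1)]
      using card_Diff_subset[OF finite_sign_changes sign_changes_subset, of d \<rho>] by simp
      then have "k + 1 = d + 1 - card (sign_changes d \<rho>)" using eq \<tau>(2) by simp
      then show False using \<rho>(2) assms by simp
    qed
    then show ?thesis using \<tau> by (auto simp: few_changes_def)
  qed
  then have "(`) ?a ` ?A \<subset> ?T - ?A" using aA by auto
  then have "card ((`) ?a ` ?A) < card (?T - ?A)" using fin by (intro psubset_card_mono) auto
  moreover have "card ((`) ?a ` ?A) = card ?A" by (intro card_image inj_img signed_perm_alternate)
  moreover have "card (?T - ?A) = card ((`) p ` (?T - ?A))" by (intro card_image[symmetric] inj_img p)
  moreover have "card ((`) p ` (?T - ?A)) \<le> card ?A" using swap fin by (intro card_mono) auto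
  ultimately show False by simp
qed

lemma carrier_automorphism_group_KN:
  assumes "1 \<le> k" "2 * k + 1 \<le> d"
  shows "carrier (automorphism_group (KN k d)) =
    {p. signed_perm d p \<and> (\<forall>\<sigma>\<in>few_changes k d. p ` \<sigma> \<in> few_changes k d)}"
proof -
  have kd: "k < d" using assms by simp
  show ?thesis
  proof (intro equalityI subsetI)
    fix p assume p: "p \<in> carrier (automorphism_group (KN k d))"
    show "p \<in> {p. signed_perm d p \<and> (\<forall>\<sigma>\<in>few_changes k d. p ` \<sigma> \<in> few_changes k d)}"
      using automorphism_signed_perm[OF assms(1) kd p] automorphism_preserves_few_changes[OF assms p]
      by blast
  next
    fix p assume p: "p \<in> {p. signed_perm d p \<and> (\<forall>\<sigma>\<in>few_changes k d. p ` \<sigma> \<in> few_changes k d)}"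
    then have "p ` \<tau> \<in> KN k d" if "\<tau> \<in> KN k d" for \<tau>
      using signed_perm_maps_KN[of d p k \<tau>] that by blast
    then show "p \<in> carrier (automorphism_group (KN k d))"
      using p by (simp add: automorphism_group_def vertices_KN[OF assms(1) kd] signed_perm_def)
  qed
qed

section \<open>Cyclic adjacency of coordinates\<close>

text \<open>Defined at every level \<open>k\<close>, so that the descent can regard one permutation
  at several levels; in the range of the theorem it is the automorphism group by
  \<open>carrier_automorphism_group_KN\<close>.\<close>

definition few_changes_perms :: "nat \<Rightarrow> nat \<Rightarrow> (vertex \<Rightarrow> vertex) set" where
  "few_changes_perms k d =
     {p. signed_perm d p \<and> (\<forall>\<sigma>\<in>few_changes k d. p ` \<sigma> \<in> few_changes k d)}"

lemma few_changes_perms_signed: "p \<in> few_changes_perms k d \<Longrightarrow> signed_perm d p"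
  by (simp add: few_changes_perms_def)

lemma few_changes_perms_image:
  "p \<in> few_changes_perms k d \<Longrightarrow> \<sigma> \<in> few_changes k d \<Longrightarrow> p ` \<sigma> \<in> few_changes k d"
  by (simp add: few_changes_perms_def)

lemma few_changes_perms_id: "id \<in> few_changes_perms k d"
  by (simp add: few_changes_perms_def signed_perm_id)

lemma few_changes_perms_comp:
  "p \<in> few_changes_perms k d \<Longrightarrow> q \<in> few_changes_perms k d \<Longrightarrow> p \<circ> q \<in> few_changes_perms k d"
  unfolding few_changes_perms_def by (simp only: mem_Collect_eq image_comp[symmetric]) (blast intro: signed_perm_comp)

lemma few_changes_perms_inv:
  assumes "p \<in> few_changes_perms k d"
  shows "inv_into UNIV p \<in> few_changes_perms k d"
proof -
  have p: "signed_perm d p" using few_changes_perms_signed[OF assms] .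
  have "bij p" using p unfolding signed_perm_def by (blast intro: permutes_bij)
  then have "p ` (inv_into UNIV p ` \<sigma>) = \<sigma>" for \<sigma> by (simp add: bij_is_surj image_f_inv_f)
  moreover have "finite (few_changes k d)" by (simp add: few_changes_def)
  ultimately have "inv_into UNIV p ` \<sigma> \<in> few_changes k d" if "\<sigma> \<in> few_changes k d" for \<sigma>
    using signed_perm_maps_onto[OF p few_changes_perms_image[OF assms], of "inv_into UNIV p ` \<sigma>"] that
    by simp
  then show ?thesis using signed_perm_inv[OF p] by (simp add: few_changes_perms_def)
qed

text \<open>By \<open>few_changes_interior\<close> the lower level is described through the upper
  one and the flips alone, and a signed permutation merely permutes the flip directions.\<close>

lemma few_changes_perms_descend:
  assumes "p \<in> few_changes_perms (c + 2) d" "2 * (c + 2) < d"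
  shows "p \<in> few_changes_perms c d"
proof -
  have p: "signed_perm d p" using few_changes_perms_signed[OF assms(1)] .
  have "p ` \<sigma> \<in> few_changes c d" if \<sigma>: "\<sigma> \<in> few_changes c d" for \<sigma>
  proof -
    have \<sigma>': "\<sigma> \<in> few_changes (c + 2) d" "\<And>i. i \<in> {1..d + 2} \<Longrightarrow> flip i \<sigma> \<in> few_changes (c + 2) d"
      using \<sigma> few_changes_interior[OF assms(2)] by auto
    have "flip i (p ` \<sigma>) \<in> few_changes (c + 2) d" if i: "i \<in> {1..d + 2}" for i
    proof -
      have "bij p" using p unfolding signed_perm_def by (blast intro: permutes_bij)
      then obtain v where v: "p v = X i" by (metis bij_pointE)
      have "idx v \<in> {1..d + 2}" using signed_perm_idx[OF p, of v] v i by auto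
      then have "p ` flip (idx v) \<sigma> \<in> few_changes (c + 2) d"
        using \<sigma>' few_changes_perms_image[OF assms(1)] by blast
      then show ?thesis using v by (simp add: signed_perm_flip[OF p] signed_perm_idx_X[OF p])
    qed
    then show ?thesis
      using few_changes_interior[OF assms(2)] few_changes_perms_image[OF assms(1) \<sigma>'(1)] by blast
  qed
  then show ?thesis using p by (simp add: few_changes_perms_def)
qed

lemma few_changes_perms_descend_to:
  assumes "p \<in> few_changes_perms (c + 2 * m) d" "2 * (c + 2 * m) < d"
  shows "p \<in> few_changes_perms c d"
  using assms
proof (induction m)
  case (Suc m)
  have eq: "c + 2 * Suc m = c + 2 * m + 2" by simp
  have "p \<in> few_changes_perms (c + 2 * m) d"
    using Suc.prems unfolding eq by (rule few_changes_perms_descend)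
  moreover have "2 * (c + 2 * m) < d" using Suc.prems(2) by simp
  ultimately show ?case by (rule Suc.IH)
qed simp

section \<open>Cyclic adjacency in terms of walls\<close>

definition cyclic_adjacent :: "nat \<Rightarrow> nat \<Rightarrow> nat \<Rightarrow> bool" where
  "cyclic_adjacent n i j \<longleftrightarrow> j = i + 1 \<or> i = j + 1 \<or> i = 1 \<and> j = n \<or> i = n \<and> j = 1"

text \<open>Neighbours share a wall, which cancels; the two end coordinates have just one wall
  each.\<close>

lemma card_walls_adjacent:
  assumes "cyclic_adjacent (d + 2) i j" "1 \<le> i" "i \<le> d + 2" "1 \<le> j" "j \<le> d + 2"
  shows "card (sym_diff (walls d i) (walls d j)) \<le> 2"
proof -
  have "\<exists>a b. sym_diff (walls d i) (walls d j) \<subseteq> {a, b}"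
  proof -
    consider "j = i + 1" | "i = j + 1" | "i = 1" "j = d + 2" | "i = d + 2" "j = 1"
      using assms(1) by (auto simp: cyclic_adjacent_def)
    then show ?thesis
    proof cases
      case 1 then show ?thesis by (intro exI[of _ "i - 1"] exI[of _ "i + 1"]) (auto simp: walls_def)
    next
      case 2 then show ?thesis by (intro exI[of _ "j - 1"] exI[of _ "j + 1"]) (auto simp: walls_def)
    next
      case 3 then show ?thesis by (intro exI[of _ 1] exI[of _ "d + 1"]) (auto simp: walls_def)
    next
      case 4 then show ?thesis by (intro exI[of _ 1] exI[of _ "d + 1"]) (auto simp: walls_def)
    qed
  qed
  then obtain a b where "sym_diff (walls d i) (walls d j) \<subseteq> {a, b}" by blast
  then have "card (sym_diff (walls d i) (walls d j)) \<le> card {a, b}" by (intro card_mono) auto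
  also have "\<dots> \<le> 2" by (simp add: card_insert_if)
  finally show ?thesis .
qed

text \<open>Distinct coordinates that are not cyclically adjacent share no wall, and at most one of
  them is an end, so at least three walls survive.\<close>

lemma card_walls_not_adjacent:
  assumes "card (sym_diff (walls d i) (walls d j)) \<le> 2"
    and "1 \<le> i" "i \<le> d + 2" "1 \<le> j" "j \<le> d + 2" "i \<noteq> j"
  shows "cyclic_adjacent (d + 2) i j"
proof -
  have *: "cyclic_adjacent (d + 2) i j"
    if "card (sym_diff (walls d i) (walls d j)) \<le> 2" "1 \<le> i" "i < j" "j \<le> d + 2" for i j
  proof (rule ccontr)
    assume n: "\<not> cyclic_adjacent (d + 2) i j"
    then have "i + 1 < j" "\<not> (i = 1 \<and> j = d + 2)" using that by (auto simp: cyclic_adjacent_def)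
    \<comment> \<open>If \<open>i = 1\<close>, its left wall is missing but both walls of
      \<open>j\<close> exist; otherwise both walls of \<open>i\<close> exist, and the left wall of
      \<open>j\<close> exists even for \<open>j = d + 2\<close>.\<close>
    then have "\<exists>S. S \<subseteq> sym_diff (walls d i) (walls d j) \<and> card S = 3"
    proof (cases "i = 1")
      case True
      then show ?thesis using that n \<open>i + 1 < j\<close>
        by (intro exI[of _ "{i, j - 1, j}"]) (auto simp: walls_def cyclic_adjacent_def)
    next
      case False
      then have "i - 1 \<noteq> i" "i - 1 \<noteq> j - 1" "i \<noteq> j - 1" using that \<open>i + 1 < j\<close> by auto
      then have "card {i - 1, i, j - 1} = 3" by simp
      moreover have "{i - 1, i, j - 1} \<subseteq> sym_diff (walls d i) (walls d j)"
        using that False \<open>i + 1 < j\<close> by (auto simp: walls_def)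
      ultimately show ?thesis by blast
    qed
    then obtain S where "S \<subseteq> sym_diff (walls d i) (walls d j)" "card S = 3" by blast
    then have "3 \<le> card (sym_diff (walls d i) (walls d j))"
      by (metis card_mono finite_Diff finite_Un finite_walls)
    then show False using that(1) by simp
  qed
  show ?thesis
  proof (cases "i < j")
    case False
    then have "cyclic_adjacent (d + 2) j i" using assms by (intro *) (auto simp: Un_commute)
    then show ?thesis by (auto simp: cyclic_adjacent_def)
  qed (use assms * in blast)
qed

lemma sign_changes_flip_flip:
  assumes "1 \<le> i" "1 \<le> j"
  shows "sign_changes d (flip j (flip i \<sigma>)) =
    sym_diff (sign_changes d \<sigma>) (sym_diff (walls d i) (walls d j))"
  unfolding sign_changes_flip[OF assms(1)] sign_changes_flip[OF assms(2)] by blast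

text \<open>For \<open>(b, b') = (0, 2)\<close> and for \<open>(b, b') = (1, 1)\<close>, coordinates \<open>i \<noteq> j\<close> are cyclically adjacent iff
  flipping both leads from some sequence with at most \<open>b\<close> changes to one with at most \<open>b'\<close> changes.\<close>

lemma few_changes_perms_adjacent:
  assumes p: "p \<in> few_changes_perms k d" and kd: "1 \<le> k" "2 * k + 1 \<le> d"
    and ij: "cyclic_adjacent (d + 2) i j" "1 \<le> i" "i \<le> d + 2" "1 \<le> j" "j \<le> d + 2"
  shows "cyclic_adjacent (d + 2) (idx (p (X i))) (idx (p (X j)))"
proof -
  \<comment> \<open>Level \<open>b\<close> is the bottom of the descent; \<open>2 - b\<close> is
    level 2 for even and level 1 for odd \<open>k\<close>. The two allowances always add up to 2,
    the bound that characterises adjacency.\<close>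
  define b where "b = k mod 2"
  have "k = b + 2 * (k div 2)" by (simp add: b_def)
  then have pb: "p \<in> few_changes_perms b d"
    using few_changes_perms_descend_to[of p b "k div 2" d] p kd by simp
  have pb': "p \<in> few_changes_perms (2 - b) d"
  proof (cases "even k")
    case True
    then have "k = 2 + 2 * ((k - 2) div 2)" using kd by (auto elim!: evenE)
    then have "p \<in> few_changes_perms 2 d"
      using few_changes_perms_descend_to[of p 2 "(k - 2) div 2" d] p kd by simp
    then show ?thesis using True by (simp add: b_def)
  next
    case False
    then have "b = 1" by (simp add: b_def odd_iff_mod_2_eq_one)
    then show ?thesis using pb by simp
  qed
  have sp: "signed_perm d p" using few_changes_perms_signed[OF p] .
  define W where "W = sym_diff (walls d i) (walls d j)"
  have W: "finite W" "card W \<le> 2" "W \<subseteq> {1..d + 1}"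
    using card_walls_adjacent[OF ij] by (auto simp: W_def walls_def)
  \<comment> \<open>Distribute the at most two toggled gaps: those in \<open>S\<close> are the
    changes before the double flip, the others the changes after it.\<close>
  have "\<exists>S\<subseteq>W. card S \<le> b \<and> card (W - S) \<le> 2 - b"
  proof (cases "even k \<or> W = {}")
    case True
    then show ?thesis using W by (intro exI[of _ "{}"]) (auto simp: b_def)
  next
    case False
    then obtain e where "e \<in> W" by blast
    moreover have "b = 1" using False by (simp add: b_def odd_iff_mod_2_eq_one)
    ultimately show ?thesis using W by (intro exI[of _ "{e}"]) auto
  qed
  then obtain S where S: "S \<subseteq> W" "card S \<le> b" "card (W - S) \<le> 2 - b" by blast
  then obtain \<sigma> where \<sigma>: "\<sigma> \<in> transversals d" "sign_changes d \<sigma> = S"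
    using transversal_of_changes[of S d] W(3) by blast
  have "sign_changes d (flip j (flip i \<sigma>)) = W - S"
    unfolding sign_changes_flip_flip[OF ij(2,4)] \<sigma>(2) W_def[symmetric] using S(1) by blast
  then have "flip j (flip i \<sigma>) \<in> few_changes (2 - b) d"
    using S \<sigma> ij by (auto simp: few_changes_def intro!: flip_transversal)
  from few_changes_perms_image[OF pb' this]
  have 1: "flip (idx (p (X j))) (flip (idx (p (X i))) (p ` \<sigma>)) \<in> few_changes (2 - b) d"
    by (simp add: signed_perm_flip[OF sp])
  have 2: "p ` \<sigma> \<in> few_changes b d"
    using few_changes_perms_image[OF pb] \<sigma> S by (simp add: few_changes_def)
  have rng: "1 \<le> idx (p (X i))" "idx (p (X i)) \<le> d + 2" "1 \<le> idx (p (X j))" "idx (p (X j)) \<le> d + 2"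
    using signed_perm_idx[OF sp, of "X i"] signed_perm_idx[OF sp, of "X j"] ij by auto
  have "idx (p (X i)) \<noteq> idx (p (X j))"
  proof
    assume "idx (p (X i)) = idx (p (X j))"
    then have "p (X i) = p (X j) \<or> p (X i) = p (Y j)"
      using signed_perm_Y[OF sp] by (simp add: idx_eq_iff)
    then have "i = j" using signed_perm_inj[OF sp] by (auto dest: injD)
    then show False using ij(1,2) by (auto simp: cyclic_adjacent_def)
  qed
  moreover have "card (sym_diff (walls d (idx (p (X i)))) (walls d (idx (p (X j))))) \<le> 2" (is "card ?W' \<le> 2")
  proof -
    let ?S = "sign_changes d (p ` \<sigma>)"
    let ?R = "sign_changes d (flip (idx (p (X j))) (flip (idx (p (X i))) (p ` \<sigma>)))"
    have "?W' = sym_diff ?S ?R"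
      unfolding sign_changes_flip_flip[OF rng(1,3)] by blast
    then have "card ?W' \<le> card ?S + card ?R" using card_sym_diff_le[of ?S ?R] by simp
    also have "\<dots> \<le> b + (2 - b)" using 1 2 by (intro add_mono) (auto simp: few_changes_def)
    also have "\<dots> = 2" by (simp add: b_def)
    finally show ?thesis .
  qed
  ultimately show ?thesis using rng by (intro card_walls_not_adjacent)
qed

text \<open>The image of 2 is one of the two neighbours of 1 and decides the direction. From then on
  every value is forced: of the two neighbours of the last value, one is already taken.\<close>

lemma cyclic_adjacency_preserving:
  assumes n: "3 \<le> n" and "inj_on f {1..n}" "f ` {1..n} \<subseteq> {1..n}" "f 1 = (1::nat)"
    and adj: "\<And>i j. i \<in> {1..n} \<Longrightarrow> j \<in> {1..n} \<Longrightarrow> cyclic_adjacent n i j \<Longrightarrow> cyclic_adjacent n (f i) (f j)"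
  shows "(\<forall>i\<in>{1..n}. f i = i) \<or> (\<forall>i\<in>{2..n}. f i = n + 2 - i)"
proof -
  have inj: "f i \<noteq> f j" if "i \<in> {1..n}" "j \<in> {1..n}" "i \<noteq> j" for i j
    using that assms(2) by (meson inj_onD)
  have rng: "1 \<le> f i" "f i \<le> n" if "1 \<le> i" "i \<le> n" for i using that assms(3) by force+
  have adj_Suc: "cyclic_adjacent n (f m) (f (Suc m))" if "1 \<le> m" "Suc m \<le> n" for m
    using that by (intro adj) (auto simp: cyclic_adjacent_def)
  have "f 2 = 2 \<or> f 2 = n"
    using adj_Suc[of 1] n assms(4) rng[of 2] by (auto simp: cyclic_adjacent_def numeral_2_eq_2)
  then show ?thesis
  proof
    assume f2: "f 2 = 2"
    \<comment> \<open>Two consecutive values are carried along, since the next value is determined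
      by excluding the one before last.\<close>
    have "f m = m \<and> (2 \<le> m \<longrightarrow> f (m - 1) = m - 1)" if "1 \<le> m" "m \<le> n" for m
      using that
    proof (induction m rule: dec_induct)
      case (step m)
      show ?case
      proof (cases "m = 1")
        case False
        then have 1: "m - 1 \<in> {1..n}" "Suc m \<in> {1..n}" "Suc m \<noteq> m - 1" "2 \<le> m"
          using step.hyps step.prems by auto
        have IH: "f m = m" "f (m - 1) = m - 1" using step.IH step.prems 1(4) by auto
        have "cyclic_adjacent n m (f (Suc m))" using adj_Suc[of m] step.hyps step.prems IH(1) by simp
        moreover have "f (Suc m) \<noteq> m - 1" using inj[OF 1(2,1,3)] IH(2) by simp
        ultimately show ?thesis using step.hyps step.prems False rng[of "Suc m"] IH
          by (auto simp: cyclic_adjacent_def)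
      qed (use assms f2 in \<open>auto simp: numeral_2_eq_2\<close>)
    qed (use assms in auto)
    then show ?thesis by auto
  next
    assume f2: "f 2 = n"
    \<comment> \<open>As before, run backwards from \<open>n\<close>. The guard
      \<open>3 \<le> m\<close> leaves out \<open>f 1 = 1\<close>, to which the formula does not
      apply.\<close>
    have "f m = n + 2 - m \<and> (3 \<le> m \<longrightarrow> f (m - 1) = n + 3 - m)" if "2 \<le> m" "m \<le> n" for m
      using that
    proof (induction m rule: dec_induct)
      case (step m)
      have IH: "f m = n + 2 - m" "3 \<le> m \<Longrightarrow> f (m - 1) = n + 3 - m"
        using step.IH step.prems by auto
      have a: "cyclic_adjacent n (n + 2 - m) (f (Suc m))"
        using adj_Suc[of m] step.hyps step.prems IH(1) by simp
      have 1: "f (Suc m) \<noteq> 1" using inj[of "Suc m" 1] step.hyps step.prems assms(4) by simp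
      have 2: "f (Suc m) \<noteq> n + 3 - m" if "3 \<le> m"
      proof -
        have "m - 1 \<in> {1..n}" "Suc m \<in> {1..n}" "Suc m \<noteq> m - 1" using that step.prems by auto
        from inj[OF this(2,1,3)] IH(2)[OF that] show ?thesis by simp
      qed
      have "f (Suc m) = n + 1 - m"
      proof (cases "m = 2")
        case True
        then show ?thesis using a 1 rng[of "Suc m"] step.prems n by (auto simp: cyclic_adjacent_def)
      next
        case False
        then have "3 \<le> m" using step.hyps by simp
        with 2 a 1 rng[of "Suc m"] step.prems show ?thesis by (auto simp: cyclic_adjacent_def)
      qed
      then show ?case using step.hyps step.prems IH by auto
    qed (use f2 in auto)
    then show ?thesis by auto
  qed
qed

text \<open>Such a \<open>p\<close> only alters signs, so it adds one fixed set of changes to every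
  \<open>sign_changes d \<sigma>\<close> by symmetric difference. That set, read off from the
  all-plus sequence, is empty: at level 0 at once, at level 1 because a single change could be
  combined with a different one. The alteration is therefore constant, and \<open>X 1\<close> shows
  that it is trivial.\<close>

lemma few_changes_perms_idx_id:
  assumes p: "p \<in> few_changes_perms k d" and kd: "1 \<le> k" "2 * k + 1 \<le> d"
    and idx: "\<And>i. 1 \<le> i \<Longrightarrow> i \<le> d + 2 \<Longrightarrow> idx (p (X i)) = i" and X1: "p (X 1) = X 1"
  shows "p = id"
proof -
  define b where "b = k mod 2"
  have "k = b + 2 * (k div 2)" by (simp add: b_def)
  then have pb: "p \<in> few_changes_perms b d"
    using few_changes_perms_descend_to[of p b "k div 2" d] p kd by simp
  have b: "b \<le> 1" by (simp add: b_def)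
  have sp: "signed_perm d p" using few_changes_perms_signed[OF p] .
  have sgn: "sign_at (p ` \<sigma>) i \<longleftrightarrow> (sign_at \<sigma> i \<longleftrightarrow> p (X i) = X i)"
    if "\<sigma> \<in> transversals d" "1 \<le> i" "i \<le> d + 2" for \<sigma> i
  proof (cases "p (X i) = X i")
    case True
    then have "X i \<in> p ` \<sigma> \<longleftrightarrow> X i \<in> \<sigma>" by (metis inj_image_mem_iff signed_perm_inj[OF sp])
    then show ?thesis using True by (simp add: sign_at_def)
  next
    case False
    then have "p (X i) = Y i" using idx[OF that(2,3)] by (cases "p (X i)") auto
    then have "p (Y i) = X i" by (simp add: signed_perm_Y[OF sp])
    then have "X i \<in> p ` \<sigma> \<longleftrightarrow> Y i \<in> \<sigma>" by (metis inj_image_mem_iff signed_perm_inj[OF sp])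
    then show ?thesis using False transversal_opp[OF that(1), of "X i"] that by (simp add: sign_at_def)
  qed
  obtain \<tau> where \<tau>: "\<tau> \<in> transversals d" "\<And>i. 1 \<le> i \<Longrightarrow> i \<le> d + 2 \<Longrightarrow> sign_at \<tau> i"
    using transversal_of_signs[of d "\<lambda>_. True"] by auto
  have "sign_changes d \<tau> = {}" using \<tau>(2) by (auto simp: sign_changes_def)
  then have "\<tau> \<in> few_changes b d" using \<tau>(1) by (simp add: few_changes_def)
  then have T: "card (sign_changes d (p ` \<tau>)) \<le> b"
    using few_changes_perms_image[OF pb] by (simp add: few_changes_def)
  have sd: "sign_changes d (p ` \<sigma>) = sym_diff (sign_changes d \<sigma>) (sign_changes d (p ` \<tau>))"
    if "\<sigma> \<in> transversals d" for \<sigma>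
    by (auto simp: sign_changes_def sgn[OF that] sgn[OF \<tau>(1)] \<tau>(2))
  have "sign_changes d (p ` \<tau>) = {}"
  proof (rule ccontr)
    assume "sign_changes d (p ` \<tau>) \<noteq> {}"
    then have c: "card (sign_changes d (p ` \<tau>)) = 1" "b = 1"
      using T b by (auto simp: le_Suc_eq)
    then obtain m where m: "sign_changes d (p ` \<tau>) = {m}" by (auto simp: card_1_singleton_iff)
    \<comment> \<open>A second gap exists because there are \<open>d + 1 \<ge> 2\<close> of
      them.\<close>
    obtain m' where m': "m' \<in> {1..d + 1}" "m' \<noteq> m"
      using kd by (cases "m = 1") (auto intro: that[of 1] that[of 2])
    obtain \<sigma> where \<sigma>: "\<sigma> \<in> transversals d" "sign_changes d \<sigma> = {m'}"
      using transversal_of_changes[of "{m'}" d] m' by auto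
    then have "\<sigma> \<in> few_changes b d" using c by (simp add: few_changes_def)
    then have "card (sign_changes d (p ` \<sigma>)) \<le> 1"
      using few_changes_perms_image[OF pb] c by (simp add: few_changes_def)
    moreover have "sign_changes d (p ` \<sigma>) = {m, m'}" using sd[OF \<sigma>(1)] \<sigma>(2) m m' by auto
    ultimately show False using m' by simp
  qed
  then have same: "\<forall>i\<in>{1..d + 2}. sign_at (p ` \<tau>) i = sign_at (p ` \<tau>) 1"
    by (simp only: sign_changes_eq_empty_iff)
  have fixX: "p (X i) = X i" if i: "1 \<le> i" "i \<le> d + 2" for i
    using bspec[OF same, of i] i sgn[OF \<tau>(1), of i] sgn[OF \<tau>(1), of 1] \<tau>(2)[of i] \<tau>(2)[of 1] X1 by simp
  have "p v = v" for v
  proof (cases "v \<in> polytope_vertices d")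
    case True
    then show ?thesis using fixX[of "idx v"] by (cases v) (auto simp: signed_perm_Y[OF sp])
  next
    case False
    then show ?thesis using sp unfolding signed_perm_def by (blast intro: permutes_not_in)
  qed
  then show ?thesis by (simp add: fun_eq_iff)
qed

section \<open>The generators\<close>

lemma perm_D_apply: "perm_D d v = (if v \<in> polytope_vertices d then opp v else v)"
proof -
  have "foldr (\<circ>) (map (\<lambda>j. cycle_of_list [X j, Y j]) js) id v = (if idx v \<in> set js then opp v else v)"
    if "distinct js" for js
    using that by (induction js) (cases v; auto simp: transpose_def)+
  from this[of "[1..<d + 3]"] show ?thesis by (auto simp: perm_D_def)
qed

text \<open>The induction runs over an arbitrary list of treated indices, in which a pair is
  represented by its smaller member. The middle coordinate, if there is one, is in no pair, and
  \<open>d + 3 - j\<close> returns it unchanged.\<close>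

lemma perm_E_apply:
  "perm_E d (X j) = X (if 1 \<le> j \<and> j \<le> d + 2 then d + 3 - j else j)"
  "perm_E d (Y j) = Y (if 1 \<le> j \<and> j \<le> d + 2 then d + 3 - j else j)"
proof -
  define m where "m = d + 3"
  let ?c = "\<lambda>j. cycle_of_list [X j, X (m - j)] \<circ> cycle_of_list [Y j, Y (m - j)]"
  let ?P = "\<lambda>js i. i \<in> set js \<and> 2 * i < m \<or> m - i \<in> set js \<and> 2 * (m - i) < m"
  let ?E = "\<lambda>js. foldr (\<circ>) (concat (map (\<lambda>j. if 2 * j < m then [?c j] else []) js)) id"
  have "?E js (X i) = X (if ?P js i then m - i else i) \<and> ?E js (Y i) = Y (if ?P js i then m - i else i)"
    if "distinct js" "0 \<notin> set js" for js i
    using that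
  proof (induction js arbitrary: i)
    case (Cons j js)
    show ?case
    proof (cases "2 * j < m")
      case False
      then have "?P (j # js) i \<longleftrightarrow> ?P js i" by auto
      then show ?thesis using Cons False by simp
    next
      case True
      have "0 < j" using Cons.prems by (cases j) auto
      have "j \<noteq> m - j" using True by simp
      then have c: "?c j (X l) = X (if l = j \<or> l = m - j then m - l else l)"
        "?c j (Y l) = Y (if l = j \<or> l = m - j then m - l else l)" for l
        using True by (simp_all add: transpose_def)
      let ?e = "if ?P js i then m - i else i"
      have "(if ?e = j \<or> ?e = m - j then m - ?e else ?e) = (if ?P (j # js) i then m - i else i)"
      proof (cases "?P js i")
        case p: True
        \<comment> \<open>The pair of \<open>i\<close> is already treated and is disjoint from the
          pair of \<open>j\<close>, so \<open>?c j\<close> leaves it alone.\<close>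
        have "i \<le> m" by (rule ccontr) (use p Cons.prems in auto)
        moreover have "i \<noteq> j" "i \<noteq> m - j" using p True Cons.prems by force+
        ultimately have "m - i \<noteq> j" "m - i \<noteq> m - j" using True by simp_all
        moreover have "?P (j # js) i" using p by (simp only: list.set(2) insert_iff) blast
        ultimately show ?thesis using p by (simp only: if_True) simp
      next
        case p: False
        have "?P (j # js) i \<longleftrightarrow> i = j \<or> i = m - j" using p True \<open>0 < j\<close> by auto
        with p show ?thesis by (simp only: if_False)
      qed
      moreover have js: "distinct js" "0 \<notin> set js" using Cons.prems by simp_all
      note conjunct1[OF Cons.IH[OF js, of i]] conjunct2[OF Cons.IH[OF js, of i]]
      moreover have "?E (j # js) = ?c j \<circ> ?E js" using True by (simp del: cycle_of_list.simps)
      ultimately show ?thesis by (simp only: o_apply[of "?c j" "?E js"] c)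
    qed
  qed simp
  from this[of "[1..<d + 3]" j]
  have "?E [1..<d + 3] (X j) = X (if ?P [1..<d + 3] j then m - j else j) \<and>
      ?E [1..<d + 3] (Y j) = Y (if ?P [1..<d + 3] j then m - j else j)"
    by (simp del: upt_Suc)
  moreover have "(if ?P [1..<d + 3] j then m - j else j) = (if 1 \<le> j \<and> j \<le> d + 2 then d + 3 - j else j)"
    unfolding set_upt m_def by auto
  moreover have "perm_E d = ?E [1..<d + 3]" by (simp only: perm_E_def m_def)
  ultimately show "perm_E d (X j) = X (if 1 \<le> j \<and> j \<le> d + 2 then d + 3 - j else j)"
    "perm_E d (Y j) = Y (if 1 \<le> j \<and> j \<le> d + 2 then d + 3 - j else j)"
    by (simp_all only:)
qed

lemma cycle_of_list_nth:
  assumes "distinct cs" "i < length cs"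
  shows "cycle_of_list cs (cs ! i) = cs ! (Suc i mod length cs)"
proof -
  have "map (cycle_of_list cs) cs = rotate 1 cs"
    using cyclic_rotation[OF assms(1), of 1] by simp
  then have "map (cycle_of_list cs) cs ! i = rotate 1 cs ! i" by simp
  then show ?thesis using assms by (simp add: nth_rotate1)
qed

lemma perm_R_apply:
  "1 \<le> j \<Longrightarrow> j \<le> d + 1 \<Longrightarrow> perm_R k d (X j) = X (j + 1)"
  "1 \<le> j \<Longrightarrow> j \<le> d + 1 \<Longrightarrow> perm_R k d (Y j) = Y (j + 1)"
  "perm_R k d (X (d + 2)) = (if even k then X 1 else Y 1)"
  "perm_R k d (Y (d + 2)) = (if even k then Y 1 else X 1)"
proof -
  let ?xs = "map X [1..<d + 3]" and ?ys = "map Y [1..<d + 3]"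
  have len: "length ?xs = d + 2" "length ?ys = d + 2" by simp_all
  have dist: "distinct ?xs" "distinct ?ys" "distinct (?xs @ ?ys)" by (auto simp: distinct_map inj_on_def)
  \<comment> \<open>List position \<open>i\<close> holds coordinate \<open>i + 1\<close>; in the
    concatenation the \<open>Y\<close> block starts at position \<open>d + 2\<close>.\<close>
  have xs: "?xs ! i = X (i + 1)" "?ys ! i = Y (i + 1)" if "i < d + 2" for i
    using that by (simp_all del: upt_Suc)
  have app: "(?xs @ ?ys) ! i = (if i < d + 2 then X (i + 1) else Y (i - (d + 2) + 1))"
    if "i < 2 * (d + 2)" for i
    using that by (simp add: nth_append len xs del: upt_Suc)
  have evX: "perm_R k d (X (Suc i)) = X (Suc i mod (d + 2) + 1)"
    and evY: "perm_R k d (Y (Suc i)) = Y (Suc i mod (d + 2) + 1)" if "even k" "i < d + 2" for i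
  proof -
    have "cycle_of_list ?xs (X (Suc i)) = X (Suc i mod (d + 2) + 1)"
      using cycle_of_list_nth[OF dist(1), of i] xs(1)[of i] xs(1)[of "Suc i mod (d + 2)"] that(2) len(1)
      by (simp del: upt_Suc map_upt_Suc)
    moreover have "cycle_of_list ?ys (Y (Suc i)) = Y (Suc i mod (d + 2) + 1)"
      using cycle_of_list_nth[OF dist(2), of i] xs(2)[of i] xs(2)[of "Suc i mod (d + 2)"] that(2) len(2)
      by (simp del: upt_Suc map_upt_Suc)
    moreover have "cycle_of_list ?ys (X l) = X l" "cycle_of_list ?xs (Y l) = Y l" for l
      by (rule id_outside_supp, auto)+
    ultimately show "perm_R k d (X (Suc i)) = X (Suc i mod (d + 2) + 1)"
      "perm_R k d (Y (Suc i)) = Y (Suc i mod (d + 2) + 1)"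
      using that(1) by (simp_all add: perm_R_def del: upt_Suc map_upt_Suc)
  qed
  have od: "perm_R k d ((?xs @ ?ys) ! i) = (?xs @ ?ys) ! (Suc i mod (2 * (d + 2)))"
    if "odd k" "i < 2 * (d + 2)" for i
    using cycle_of_list_nth[OF dist(3), of i] that len by (simp add: perm_R_def del: upt_Suc map_upt_Suc)
  have odX: "perm_R k d (X (Suc i)) = (if Suc i < d + 2 then X (Suc i + 1) else Y 1)"
    and odY: "perm_R k d (Y (Suc i)) = (if Suc i < d + 2 then Y (Suc i + 1) else X 1)"
    if "odd k" "i < d + 2" for i
  proof -
    have "Suc i < 2 * (d + 2)" using that(2) by simp
    then have "perm_R k d ((?xs @ ?ys) ! i) = (?xs @ ?ys) ! Suc i" using od[of i] that(1) by simp
    then show "perm_R k d (X (Suc i)) = (if Suc i < d + 2 then X (Suc i + 1) else Y 1)"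
      using app[of i] app[of "Suc i"] that(2) by (auto simp del: upt_Suc map_upt_Suc split: if_splits)
    have "perm_R k d ((?xs @ ?ys) ! (d + 2 + i)) = (?xs @ ?ys) ! (Suc (d + 2 + i) mod (2 * (d + 2)))"
      using od[of "d + 2 + i"] that by simp
    moreover have "Suc (d + 2 + i) mod (2 * (d + 2)) = (if Suc i < d + 2 then d + 2 + Suc i else 0)"
    proof (cases "Suc i = d + 2")
      case True
      then have "Suc (d + 2 + i) = 2 * (d + 2)" by simp
      then show ?thesis using True by (simp only: mod_self less_irrefl if_False)
    qed (use that(2) in auto)
    ultimately show "perm_R k d (Y (Suc i)) = (if Suc i < d + 2 then Y (Suc i + 1) else X 1)"
      using app[of "d + 2 + i"] app[of "d + 2 + Suc i"] app[of 0] that(2)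
      by (auto simp del: upt_Suc map_upt_Suc split: if_splits)
  qed
  show "perm_R k d (X j) = X (j + 1)" "perm_R k d (Y j) = Y (j + 1)" if "1 \<le> j" "j \<le> d + 1"
    using evX[of "j - 1"] evY[of "j - 1"] odX[of "j - 1"] odY[of "j - 1"] that
    by (cases "even k"; simp)+
  show "perm_R k d (X (d + 2)) = (if even k then X 1 else Y 1)"
    "perm_R k d (Y (d + 2)) = (if even k then Y 1 else X 1)"
    using evX[of "d + 1"] evY[of "d + 1"] odX[of "d + 1"] odY[of "d + 1"]
    by (cases "even k"; simp)+
qed

lemma involution_permutes:
  assumes "\<And>v. p (p v) = v" "\<And>v. v \<notin> S \<Longrightarrow> p v = v"
  shows "p permutes S"
  unfolding permutes_def using assms by metis

lemma signed_perm_D: "signed_perm d (perm_D d)"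
  unfolding signed_perm_def by (intro conjI involution_permutes allI) (auto simp: perm_D_apply)

lemma signed_perm_E: "signed_perm d (perm_E d)"
proof -
  have "perm_E d (perm_E d v) = v" for v by (cases v) (auto simp: perm_E_apply)
  moreover have "perm_E d v = v" if "v \<notin> polytope_vertices d" for v
    using that by (cases v) (auto simp: perm_E_apply)
  moreover have "perm_E d (opp v) = opp (perm_E d v)" for v
    by (cases v) (simp_all add: perm_E_apply)
  ultimately show ?thesis unfolding signed_perm_def by (blast intro: involution_permutes)
qed

lemma signed_perm_R: "signed_perm d (perm_R k d)"
proof -
  have sub: "set (map X [1..<d + 3]) \<subseteq> polytope_vertices d" "set (map Y [1..<d + 3]) \<subseteq> polytope_vertices d"
    "set (map X [1..<d + 3] @ map Y [1..<d + 3]) \<subseteq> polytope_vertices d"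
    by auto
  have p: "perm_R k d permutes polytope_vertices d"
    unfolding perm_R_def
    using permutes_subset[OF cycle_permutes sub(1)] permutes_subset[OF cycle_permutes sub(2)]
      permutes_subset[OF cycle_permutes sub(3)]
    by (simp add: permutes_compose)
  have "perm_R k d (opp v) = opp (perm_R k d v)" for v
  proof (cases "v \<in> polytope_vertices d")
    case False
    then have "opp v \<notin> polytope_vertices d" by simp
    then show ?thesis using False permutes_not_in[OF p] by simp
  next
    case True
    then consider "1 \<le> idx v" "idx v \<le> d + 1" | "idx v = d + 2" by fastforce
    then show ?thesis
      by cases (cases v; simp add: perm_R_apply[simplified])+
  qed
  with p show ?thesis by (simp add: signed_perm_def)
qed

section \<open>Sign changes under the generators\<close>

lemma sign_at_image:
  assumes "signed_perm d p" "p v = X i"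
  shows "sign_at (p ` \<sigma>) i \<longleftrightarrow> v \<in> \<sigma>"
  unfolding sign_at_def using assms by (metis inj_image_mem_iff signed_perm_inj)

lemma perm_D_few_changes: "perm_D d \<in> few_changes_perms k d"
proof -
  have "perm_D d ` \<sigma> \<in> few_changes k d" if "\<sigma> \<in> few_changes k d" for \<sigma>
  proof -
    have \<sigma>: "\<sigma> \<in> transversals d" using that few_changes_transversal by blast
    have "sign_at (perm_D d ` \<sigma>) i \<longleftrightarrow> \<not> sign_at \<sigma> i" if "1 \<le> i" "i \<le> d + 2" for i
      using sign_at_image[OF signed_perm_D, of d "Y i" i \<sigma>] that transversal_mem_iff[OF \<sigma>, of i]
      by (simp add: perm_D_apply)
    then have "sign_changes d (perm_D d ` \<sigma>) = sign_changes d \<sigma>" by (auto simp: sign_changes_def)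
    then show ?thesis using that signed_perm_transversal[OF signed_perm_D \<sigma>] by (simp add: few_changes_def)
  qed
  then show ?thesis by (simp add: few_changes_perms_def signed_perm_D)
qed

text \<open>Reversal moves the change at gap \<open>i\<close> to gap \<open>d + 2 - i\<close>; one
  inclusion suffices, since only an upper bound is wanted.\<close>

lemma perm_E_few_changes: "perm_E d \<in> few_changes_perms k d"
proof -
  have "perm_E d ` \<sigma> \<in> few_changes k d" if "\<sigma> \<in> few_changes k d" for \<sigma>
  proof -
    have \<sigma>: "\<sigma> \<in> transversals d" using that few_changes_transversal by blast
    have sgn: "sign_at (perm_E d ` \<sigma>) i \<longleftrightarrow> sign_at \<sigma> (d + 3 - i)" if "1 \<le> i" "i \<le> d + 2" for i
    proof -
      have "perm_E d (X (d + 3 - i)) = X i" using that by (auto simp: perm_E_apply)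
      from sign_at_image[OF signed_perm_E this] show ?thesis by (simp add: sign_at_def[of \<sigma>])
    qed
    have "sign_changes d (perm_E d ` \<sigma>) \<subseteq> (\<lambda>i. d + 2 - i) ` sign_changes d \<sigma>"
    proof
      fix i assume i: "i \<in> sign_changes d (perm_E d ` \<sigma>)"
      then have "1 \<le> i" "i \<le> d + 1" by (auto simp: sign_changes_def)
      moreover from this have "d + 3 - (i + 1) = d + 2 - i" "d + 3 - i = d + 2 - i + 1" by auto
      ultimately have "d + 2 - i \<in> sign_changes d \<sigma>" using i sgn[of i] sgn[of "i + 1"]
        by (auto simp: sign_changes_def)
      moreover have "i = d + 2 - (d + 2 - i)" using \<open>i \<le> d + 1\<close> by simp
      ultimately show "i \<in> (\<lambda>i. d + 2 - i) ` sign_changes d \<sigma>" by blast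
    qed
    then have "card (sign_changes d (perm_E d ` \<sigma>)) \<le> card (sign_changes d \<sigma>)"
      by (rule surj_card_le[OF finite_sign_changes])
    then show ?thesis using that signed_perm_transversal[OF signed_perm_E \<sigma>] by (simp add: few_changes_def)
  qed
  then show ?thesis by (simp add: few_changes_perms_def signed_perm_E)
qed

text \<open>Each change toggles the sign, so the parity of their number compares the two ends. The
  twist of \<open>perm_R\<close> for odd \<open>k\<close> rests on this.\<close>

lemma even_card_sign_changes:
  "even (card (sign_changes d \<sigma>)) \<longleftrightarrow> sign_at \<sigma> (d + 2) = sign_at \<sigma> 1"
proof -
  have "even (card (sign_changes d \<sigma> \<inter> {..<i})) \<longleftrightarrow> sign_at \<sigma> i = sign_at \<sigma> 1"
    if "1 \<le> i" "i \<le> d + 2" for i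
    using that
  proof (induction i rule: dec_induct)
    case base
    have "sign_changes d \<sigma> \<inter> {..<1} = {}" by (auto simp: sign_changes_def)
    then show ?case by simp
  next
    case (step i)
    have "sign_changes d \<sigma> \<inter> {..<Suc i} =
        (if i \<in> sign_changes d \<sigma> then insert i (sign_changes d \<sigma> \<inter> {..<i}) else sign_changes d \<sigma> \<inter> {..<i})"
      by (auto simp: less_Suc_eq)
    then have "even (card (sign_changes d \<sigma> \<inter> {..<Suc i})) \<longleftrightarrow>
        (even (card (sign_changes d \<sigma> \<inter> {..<i})) \<longleftrightarrow> i \<notin> sign_changes d \<sigma>)"
      by simp
    moreover have "i \<in> sign_changes d \<sigma> \<longleftrightarrow> sign_at \<sigma> (Suc i) \<noteq> sign_at \<sigma> i"
      using step.hyps step.prems by (auto simp: sign_changes_def)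
    ultimately show ?case using step.IH step.prems by auto
  qed
  from this[of "d + 2"] have "even (card (sign_changes d \<sigma> \<inter> {..<d + 2})) \<longleftrightarrow> sign_at \<sigma> (d + 2) = sign_at \<sigma> 1"
    by simp
  moreover have "sign_changes d \<sigma> \<inter> {..<d + 2} = sign_changes d \<sigma>" by (auto simp: sign_changes_def)
  ultimately show ?thesis by simp
qed

text \<open>The rotation is twisted so that it keeps the parity of the number of cyclic sign changes: a new
  change at the first position arises only if the number of changes has the wrong parity, in particular
  is less than \<open>k\<close>.\<close>

lemma perm_R_few_changes: "perm_R k d \<in> few_changes_perms k d"
proof -
  have "perm_R k d ` \<sigma> \<in> few_changes k d" if "\<sigma> \<in> few_changes k d" for \<sigma>
  proof -
    let ?S = "sign_changes d \<sigma>" and ?S' = "sign_changes d (perm_R k d ` \<sigma>)"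
    have \<sigma>: "\<sigma> \<in> transversals d" "card ?S \<le> k" using that by (auto simp: few_changes_def)
    have sgn: "sign_at (perm_R k d ` \<sigma>) (i + 1) \<longleftrightarrow> sign_at \<sigma> i" if "1 \<le> i" "i \<le> d + 1" for i
      using sign_at_image[OF signed_perm_R perm_R_apply(1)[OF that]] by (simp add: sign_at_def[of \<sigma>])
    have sgn1: "sign_at (perm_R k d ` \<sigma>) 1 \<longleftrightarrow> (sign_at \<sigma> (d + 2) \<longleftrightarrow> even k)"
      using sign_at_image[OF signed_perm_R, of k d "X (d + 2)" 1 \<sigma>]
        sign_at_image[OF signed_perm_R, of k d "Y (d + 2)" 1 \<sigma>]
        transversal_mem_iff[OF \<sigma>(1), of "d + 2"] perm_R_apply(3,4)[of k d]
      by (cases "even k") auto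
    have shift: "i \<in> Suc ` ?S" if i: "i \<in> ?S'" "i \<noteq> 1" for i
    proof -
      obtain j where j: "i = Suc j" using i by (cases i) (auto simp: sign_changes_def)
      have "1 \<le> j" "j \<le> d" using i j by (auto simp: sign_changes_def)
      then have "j \<in> ?S" using i(1) j sgn[of j] sgn[of "Suc j"] by (auto simp: sign_changes_def)
      then show ?thesis using j by blast
    qed
    have "card ?S' \<le> k"
    proof (cases "card ?S = k")
      case True
      \<comment> \<open>By parity the last sign equals the first iff \<open>k\<close> is even, so
        after the twist the sign arriving in position 1 agrees with the old first sign, now in
        position 2.\<close>
      then have "1 \<notin> ?S'"
        using even_card_sign_changes[of d \<sigma>] sgn[of 1] sgn1 by (auto simp: sign_changes_def)
      then have "?S' \<subseteq> Suc ` ?S" using shift by blast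
      from surj_card_le[OF finite_sign_changes this] show ?thesis using \<sigma>(2) by simp
    next
      case False
      have "?S' \<subseteq> insert 1 (Suc ` ?S)" using shift by blast
      then have "card ?S' \<le> card (insert 1 (Suc ` ?S))" by (intro card_mono) auto
      also have "\<dots> \<le> Suc (card ?S)" using card_insert_le_m1[of "Suc (card ?S)" "Suc ` ?S" 1] by (simp add: card_image)
      finally show ?thesis using False \<sigma>(2) by simp
    qed
    then show ?thesis using signed_perm_transversal[OF signed_perm_R \<sigma>(1)] by (simp add: few_changes_def)
  qed
  then show ?thesis by (simp add: few_changes_perms_def signed_perm_R)
qed

section \<open>The automorphism group\<close>

text \<open>The reflection of the cycle of coordinates that fixes coordinate 1. For odd
  \<open>k\<close> the twisted rotation would send \<open>X 1\<close> to \<open>Y 1\<close>, which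
  the factor \<open>perm_D d\<close> corrects.\<close>

definition reflection :: "nat \<Rightarrow> nat \<Rightarrow> vertex \<Rightarrow> vertex" where
  "reflection k d = (if even k then perm_R k d \<circ> perm_E d else perm_D d \<circ> (perm_R k d \<circ> perm_E d))"

lemma reflection_few_changes: "reflection k d \<in> few_changes_perms k d"
  by (simp add: reflection_def few_changes_perms_comp perm_D_few_changes perm_E_few_changes perm_R_few_changes)

lemma reflection_X1: "reflection k d (X 1) = X 1"
  using perm_R_apply(3)[of k d] by (auto simp: reflection_def perm_E_apply perm_D_apply)

lemma idx_reflection: "2 \<le> i \<Longrightarrow> i \<le> d + 2 \<Longrightarrow> idx (reflection k d (X i)) = d + 4 - i"
  using perm_R_apply(1)[of "d + 3 - i" d k] by (auto simp: reflection_def perm_E_apply perm_D_apply)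

text \<open>On coordinates \<open>q\<close> is either the identity or the reflection fixing 1, and
  \<open>few_changes_perms_idx_id\<close> removes the remaining freedom in the signs.\<close>

lemma few_changes_perms_fixing_X1:
  assumes q: "q \<in> few_changes_perms k d" and kd: "1 \<le> k" "2 * k + 1 \<le> d" and X1: "q (X 1) = X 1"
  shows "q = id \<or> q = reflection k d"
proof -
  let ?r = "reflection k d"
  have reversing: "q \<circ> ?r = id"
    if q: "q \<in> few_changes_perms k d" and X1: "q (X 1) = X 1"
      and idx: "\<And>i. 2 \<le> i \<Longrightarrow> i \<le> d + 2 \<Longrightarrow> idx (q (X i)) = d + 4 - i" for q
  proof (rule few_changes_perms_idx_id[OF _ kd])
    show "q \<circ> ?r \<in> few_changes_perms k d" by (intro few_changes_perms_comp q reflection_few_changes)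
    show "(q \<circ> ?r) (X 1) = X 1" by (simp only: o_apply reflection_X1 X1)
    fix i assume i: "1 \<le> i" "i \<le> d + 2"
    show "idx ((q \<circ> ?r) (X i)) = i"
    proof (cases "i = 1")
      case True
      then show ?thesis by (simp only: o_apply reflection_X1 X1 idx.simps)
    next
      case False
      then have "idx (?r (X i)) = d + 4 - i" using i by (intro idx_reflection) auto
      then have "idx (q (?r (X i))) = idx (q (X (d + 4 - i)))"
        using signed_perm_idx_X[OF few_changes_perms_signed[OF q], of "?r (X i)"] by simp
      also have "\<dots> = i" using i False by (subst idx) auto
      finally show ?thesis by simp
    qed
  qed
  have sq: "signed_perm d q" using few_changes_perms_signed[OF q] .
  have "(\<forall>i\<in>{1..d + 2}. idx (q (X i)) = i) \<or> (\<forall>i\<in>{2..d + 2}. idx (q (X i)) = d + 2 + 2 - i)"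
  proof (rule cyclic_adjacency_preserving)
    show "3 \<le> d + 2" using kd by simp
    show "inj_on (\<lambda>i. idx (q (X i))) {1..d + 2}"
    proof (rule inj_onI)
      fix i j assume "idx (q (X i)) = idx (q (X j))"
      then have "q (X i) = q (X j) \<or> q (X i) = q (Y j)" using signed_perm_Y[OF sq] by (simp add: idx_eq_iff)
      then show "i = j" using signed_perm_inj[OF sq] by (auto dest: injD)
    qed
    show "(\<lambda>i. idx (q (X i))) ` {1..d + 2} \<subseteq> {1..d + 2}"
    proof
      fix l assume "l \<in> (\<lambda>i. idx (q (X i))) ` {1..d + 2}"
      then obtain i where "i \<in> {1..d + 2}" "l = idx (q (X i))" by blast
      then show "l \<in> {1..d + 2}" using signed_perm_idx[OF sq, of "X i"] by simp
    qed
    show "idx (q (X 1)) = 1" by (simp only: X1 idx.simps)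
    show "cyclic_adjacent (d + 2) (idx (q (X i))) (idx (q (X j)))"
      if "i \<in> {1..d + 2}" "j \<in> {1..d + 2}" "cyclic_adjacent (d + 2) i j" for i j
      using few_changes_perms_adjacent[OF q kd that(3)] that(1,2) by simp
  qed
  then show ?thesis
  proof
    assume "\<forall>i\<in>{1..d + 2}. idx (q (X i)) = i"
    then show ?thesis using few_changes_perms_idx_id[OF q kd _ X1] by simp
  next
    assume *: "\<forall>i\<in>{2..d + 2}. idx (q (X i)) = d + 2 + 2 - i"
    have "q \<circ> ?r = id" by (rule reversing[OF q X1]) (use * in auto)
    \<comment> \<open>The same argument applied to the reflection itself makes it an involution, so
      it can be cancelled from \<open>q \<circ> ?r = id\<close>.\<close>
    moreover have "?r \<circ> ?r = id"
      by (rule reversing[OF reflection_few_changes reflection_X1 idx_reflection])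
    ultimately have "q = ?r" by (metis comp_assoc comp_id id_comp)
    then show ?thesis ..
  qed
qed

text \<open>Coset representatives for the stabiliser of \<open>X 1\<close>: for
  \<open>a < d + 2\<close> the pair \<open>(a, b)\<close> encodes the image of
  \<open>X 1\<close>.\<close>

definition rotation :: "nat \<Rightarrow> nat \<Rightarrow> nat \<Rightarrow> bool \<Rightarrow> vertex \<Rightarrow> vertex" where
  "rotation k d a b = (perm_R k d ^^ a) \<circ> (if b then perm_D d else id)"

definition normal_form :: "nat \<Rightarrow> nat \<Rightarrow> nat \<times> bool \<times> bool \<Rightarrow> vertex \<Rightarrow> vertex" where
  "normal_form k d = (\<lambda>(a, b, c). rotation k d a b \<circ> (if c then reflection k d else id))"

lemma rotation_X1: "a < d + 2 \<Longrightarrow> rotation k d a b (X 1) = (if b then Y (a + 1) else X (a + 1))"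
proof -
  have "(perm_R k d ^^ a) (X 1) = X (a + 1) \<and> (perm_R k d ^^ a) (Y 1) = Y (a + 1)" if "a < d + 2"
    using that by (induction a) (simp_all add: perm_R_apply(1,2)[simplified])
  moreover assume "a < d + 2"
  ultimately show ?thesis by (auto simp: rotation_def perm_D_apply)
qed

lemma rotation_few_changes: "rotation k d a b \<in> few_changes_perms k d"
proof -
  have "perm_R k d ^^ a \<in> few_changes_perms k d"
    by (induction a) (simp_all only: funpow.simps few_changes_perms_id few_changes_perms_comp perm_R_few_changes)
  then show ?thesis
    unfolding rotation_def
    by (cases b) (simp_all only: if_True if_False few_changes_perms_comp few_changes_perms_id perm_D_few_changes)
qed

text \<open>Undoing the rotation that agrees with \<open>p\<close> on \<open>X 1\<close> leaves an
  element of the stabiliser of \<open>X 1\<close>, which has only two possibilities.\<close>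

lemma normal_form_surj:
  assumes p: "p \<in> few_changes_perms k d" and kd: "1 \<le> k" "2 * k + 1 \<le> d"
  shows "p \<in> normal_form k d ` ({..<d + 2} \<times> UNIV)"
proof -
  let ?a = "idx (p (X 1)) - 1" and ?b = "p (X 1) = Y (idx (p (X 1)))"
  let ?g = "rotation k d ?a ?b"
  have i: "1 \<le> idx (p (X 1))" "idx (p (X 1)) \<le> d + 2"
    using signed_perm_idx[OF few_changes_perms_signed[OF p], of "X 1"] by auto
  then have "?g (X 1) = p (X 1)"
    using rotation_X1[of ?a d k ?b] by (cases "p (X 1)") auto
  moreover have "bij ?g"
    using few_changes_perms_signed[OF rotation_few_changes] unfolding signed_perm_def
    by (blast intro: permutes_bij)
  ultimately have "(inv_into UNIV ?g \<circ> p) (X 1) = X 1" by (metis bij_inv_eq_iff o_apply)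
  moreover have "inv_into UNIV ?g \<circ> p \<in> few_changes_perms k d"
    by (intro few_changes_perms_comp few_changes_perms_inv rotation_few_changes p)
  ultimately obtain c where c: "inv_into UNIV ?g \<circ> p = (if c then reflection k d else id)"
    using few_changes_perms_fixing_X1[OF _ kd] by metis
  have "p = ?g \<circ> (inv_into UNIV ?g \<circ> p)"
    using \<open>bij ?g\<close> by (simp add: fun_eq_iff bij_is_surj surj_f_inv_f)
  then have "p = normal_form k d (?a, ?b, c)" unfolding c normal_form_def by simp
  moreover have "?a < d + 2" using i by simp
  ultimately show ?thesis by blast
qed

text \<open>The reflection fixes \<open>X 1\<close>, so the image of \<open>X 1\<close> reveals
  \<open>a\<close> and \<open>b\<close>. The last parameter is then visible because the reflection
  moves coordinate 2 to \<open>d + 2\<close>.\<close>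

lemma normal_form_inj:
  assumes "1 \<le> d"
  shows "inj_on (normal_form k d) ({..<d + 2} \<times> UNIV)"
proof (rule inj_onI)
  fix x y :: "nat \<times> bool \<times> bool"
  assume xy: "x \<in> {..<d + 2} \<times> UNIV" "y \<in> {..<d + 2} \<times> UNIV" "normal_form k d x = normal_form k d y"
  obtain a b c a' b' c' where [simp]: "x = (a, b, c)" "y = (a', b', c')" by (cases x; cases y)
  have a: "a < d + 2" "a' < d + 2" and eq: "normal_form k d (a, b, c) = normal_form k d (a', b', c')"
    using xy by simp_all
  have X1: "normal_form k d (a, b, c) (X 1) = (if b then Y (a + 1) else X (a + 1))" if "a < d + 2" for a b c
    using rotation_X1[OF that, of k b] reflection_X1[of k d] by (auto simp: normal_form_def)
  have ab: "a = a'" "b = b'"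
    using X1[OF a(1), of b c] X1[OF a(2), of b' c'] eq by (auto split: if_splits)
  let ?g = "rotation k d a b"
  have "inj ?g" by (rule signed_perm_inj[OF few_changes_perms_signed[OF rotation_few_changes]])
  have "(if c then reflection k d else id) = (if c' then reflection k d else id)"
  proof
    fix v
    have "?g ((if c then reflection k d else id) v) = ?g ((if c' then reflection k d else id) v)"
      using fun_cong[OF eq, of v] ab by (simp add: normal_form_def)
    then show "(if c then reflection k d else id) v = (if c' then reflection k d else id) v"
      using \<open>inj ?g\<close> by (rule injD[rotated])
  qed
  moreover have "reflection k d \<noteq> id"
  proof
    assume "reflection k d = id"
    then show False using idx_reflection[of 2 d k] assms by simp
  qed
  ultimately have "c = c'" by (auto split: if_splits)
  with ab show "x = y" by simp
qed

section \<open>Generation inside the symmetric group and the final count\<close>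

lemma symmetric_group_on_simps:
  "carrier (symmetric_group_on V) = {p. p permutes V}"
  "p \<otimes>\<^bsub>symmetric_group_on V\<^esub> q = p \<circ> q"
  "\<one>\<^bsub>symmetric_group_on V\<^esub> = id"
  by (simp_all add: symmetric_group_on_def)

lemma group_symmetric_group_on: "group (symmetric_group_on V)"
proof (rule groupI)
  show "\<exists>y\<in>carrier (symmetric_group_on V). y \<otimes>\<^bsub>symmetric_group_on V\<^esub> x = \<one>\<^bsub>symmetric_group_on V\<^esub>"
    if "x \<in> carrier (symmetric_group_on V)" for x
    using that permutes_inv[of x V] permutes_inv_o(2)[of x V] by (auto simp: symmetric_group_on_def)
qed (auto simp: symmetric_group_on_def permutes_id comp_assoc intro: permutes_compose)

lemma inv_symmetric_group_on:
  assumes "p permutes V"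
  shows "inv\<^bsub>symmetric_group_on V\<^esub> p = inv_into UNIV p"
  using assms permutes_inv_o(2)[OF assms] permutes_inv[OF assms]
  by (intro group.inv_equality[OF group_symmetric_group_on]) (auto simp: symmetric_group_on_def)

text \<open>The generators lie in a set closed under composition and inverses; conversely every
  normal form is a word in the generators.\<close>

lemma generate_few_changes_perms:
  assumes "1 \<le> k" "2 * k + 1 \<le> d"
  shows "generate (symmetric_group_on (polytope_vertices d)) {perm_D d, perm_E d, perm_R k d} =
    few_changes_perms k d" (is "generate ?G ?H = _")
proof (intro equalityI subsetI)
  have H: "h \<in> few_changes_perms k d" if "h \<in> ?H" for h
    using that perm_D_few_changes perm_E_few_changes perm_R_few_changes by auto
  fix p assume "p \<in> generate ?G ?H"
  then show "p \<in> few_changes_perms k d"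
  proof induction
    case one
    show ?case by (simp only: symmetric_group_on_simps few_changes_perms_id)
  next
    case (incl h)
    then show ?case by (rule H)
  next
    case (inv h)
    then have "h permutes polytope_vertices d" using few_changes_perms_signed[OF H[OF inv]] unfolding signed_perm_def by blast
    then show ?case using few_changes_perms_inv[OF H[OF inv]] by (simp only: inv_symmetric_group_on)
  next
    case (eng h1 h2)
    then show ?case by (simp only: symmetric_group_on_simps few_changes_perms_comp)
  qed
next
  have comp: "f \<circ> g \<in> generate ?G ?H" if "f \<in> generate ?G ?H" "g \<in> generate ?G ?H" for f g
    using generate.eng[OF that] by (simp only: symmetric_group_on_simps)
  have id: "id \<in> generate ?G ?H" using generate.one[of ?G ?H] by (simp only: symmetric_group_on_simps)
  have gen: "perm_D d \<in> generate ?G ?H" "perm_E d \<in> generate ?G ?H" "perm_R k d \<in> generate ?G ?H"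
    by (auto intro: generate.incl)
  have pow: "perm_R k d ^^ a \<in> generate ?G ?H" for a
    by (induction a) (simp_all only: funpow.simps comp gen id)
  have refl: "reflection k d \<in> generate ?G ?H"
    unfolding reflection_def by (cases "even k") (simp_all only: if_True if_False comp gen)
  fix p assume "p \<in> few_changes_perms k d"
  from normal_form_surj[OF this assms] obtain a b c where "p = normal_form k d (a, b, c)" by auto
  then show "p \<in> generate ?G ?H"
    unfolding normal_form_def rotation_def
    by (cases b; cases c) (simp_all only: prod.case if_True if_False comp id gen pow refl)
qed

theorem mainTheorem18:
  fixes k d :: nat
  assumes "1 \<le> k" and "2 * k + 1 \<le> d"
  shows "order (automorphism_group (KN k d)) = 4 * d + 8 \<and>
         carrier (automorphism_group (KN k d)) =
           generate (symmetric_group_on (vertices (KN k d))) {perm_D d, perm_E d, perm_R k d}"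
proof
  have aut: "carrier (automorphism_group (KN k d)) = few_changes_perms k d"
    using carrier_automorphism_group_KN[OF assms] by (simp add: few_changes_perms_def)
  have "few_changes_perms k d = normal_form k d ` ({..<d + 2} \<times> UNIV)"
    using normal_form_surj[OF _ assms] few_changes_perms_comp[OF rotation_few_changes]
      few_changes_perms_id reflection_few_changes
    by (auto simp: normal_form_def)
  then have "card (few_changes_perms k d) = card ({..<d + 2} \<times> (UNIV :: (bool \<times> bool) set))"
    using normal_form_inj[of d k] assms by (simp add: card_image)
  also have "\<dots> = 4 * d + 8" by (simp add: card_cartesian_product UNIV_Times_UNIV[symmetric] del: UNIV_Times_UNIV)
  finally show "order (automorphism_group (KN k d)) = 4 * d + 8" by (simp add: order_def aut)
  show "carrier (automorphism_group (KN k d)) =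
      generate (symmetric_group_on (vertices (KN k d))) {perm_D d, perm_E d, perm_R k d}"
    using assms by (simp add: aut generate_few_changes_perms vertices_KN)
qed

end
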